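(* Let $\sigma \colon I \times \mathbb{R}^{m-1} \to \mathbb{R}^{m+n}$ be a rank-one ruled submanifold. Then there is an open dense subset $W \subset I \times \mathbb{R}^{m-1}$ such that every point of $W$ has an open neighborhood $V \subset W$ on which $\sigma|_{V}$ is, after a diffeomorphic change of parameters, the restriction to an open set of a cylindrical submanifold, of a conical submanifold, or of a tangent submanifold of some regular $(m-1)$-dimensional submanifold. In this sense, an open and dense subset of every rank-one submanifold is a union of cylindrical, conical and tangent submanifolds.
   Context: A (parametrized) submanifold of $\mathbb{R}^{m+n}$ is a smooth map $V \to \mathbb{R}^{m+n}$ with $V \subset \mathbb{R}^{m}$. A point of $V$ is regular if the differential there is injective and singular otherwise; the submanifold is regular if all of its points are regular and singular otherwise. Ruled submanifold: given an open interval $I$, a smooth unit-speed curve $\gamma \colon I \to \mathbb{R}^{m+n}$ and smooth vector fields $X_{1}, \dotsc, X_{m-1}$ along $\gamma$ that are orthonormal at each $t$, the map $\sigma(t,u^{1},\dotsc,u^{m-1}) = \gamma(t) + \sum_{j=1}^{m-1} u^{j} X_{j}(t)$ on $I \times \mathbb{R}^{m-1}$ is a ruled submanifold. At a regular point, $\sigma$ is locally an immersed $m$-dimensional submanifold with second fundamental form $\mathit{II}$. The relative nullity index at a regular point is $\dim \ker \mathit{II}$ there. A ruled submanifold is rank-one if its relative nullity index equals $m-1$ at every regular point. Cylinder: given a smooth unit-speed curve $\gamma \colon I \to \mathbb{R}^{m+n}$ and constant orthonormal vectors $X_{1},\dotsc,X_{m-1}$, the map $(t,u) \mapsto \gamma(t)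 + \sum_{j} u^{j}X_{j}$ on $I \times \mathbb{R}^{m-1}$. Cone: given $U \subset \mathbb{R}^{m-1}$ and a smooth map $\psi \colon U \to \mathbb{R}^{m+n}$ whose differential has rank $m-2$ everywhere, together with a smooth unit vector field $X_{\psi}$ along $\psi$ with $X_{\psi} \notin \operatorname{Span}(\partial\psi/\partial u^{1},\dotsc,\partial\psi/\partial u^{m-1})$ at every point, the map $(u^{1},\dotsc,u^{m}) \mapsto \psi(u^{1},\dotsc,u^{m-1}) + u^{m}X_{\psi}(u^{1},\dotsc,u^{m-1})$ on $U \times \mathbb{R}$. Tangent submanifold: given a regular $(m-1)$-dimensional submanifold $\xi \colon U \to \mathbb{R}^{m+n}$ with $U \subset \mathbb{R}^{m-1}$, together with a smooth unit vector field $X_{\xi}$ along $\xi$ with $\partial\xi/\partial u^{1} \wedge \dotsb \wedge \partial \xi/\partial u^{m-1} \wedge X_{\xi} = 0$ everywhere, the map $(u^{1},\dotsc,u^{m}) \mapsto \xi(u^{1},\dotsc,u^{m-1}) + u^{m}X_{\xi}(u^{1},\dotsc,u^{m-1})$ on $U \times \mathbb{R}$. *)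

theory Defs
  imports "HOL-Analysis.Analysis"
begin

text \<open>C^k via iterated directional (Frechet) derivatives; all iterates stay of the same type.\<close>
fun C_k :: "nat \<Rightarrow> 'a::euclidean_space set \<Rightarrow> ('a \<Rightarrow> 'b::real_normed_vector) \<Rightarrow> bool" where
  "C_k 0 S f = continuous_on S f"
| "C_k (Suc k) S f =
     ((\<forall>x\<in>S. f differentiable (at x)) \<and>
      (\<forall>v. C_k k S (\<lambda>x. frechet_derivative f (at x) v)))"

definition smooth_on :: "'a::euclidean_space set \<Rightarrow> ('a \<Rightarrow> 'b::real_normed_vector) \<Rightarrow> bool" where
  "smooth_on S f \<longleftrightarrow> open S \<and> (\<forall>k. C_k k S f)"

definition diffeo_between :: "'a::euclidean_space set \<Rightarrow> 'b::euclidean_space set \<Rightarrow> ('a \<Rightarrow> 'b) \<Rightarrow> bool" where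
  "diffeo_between V V' \<phi> \<longleftrightarrow> smooth_on V \<phi> \<and> \<phi> ` V = V' \<and> inj_on \<phi> V \<and>
     smooth_on V' (inv_into V \<phi>)"

definition regular_point :: "('p::euclidean_space \<Rightarrow> 'a::euclidean_space) \<Rightarrow> 'p \<Rightarrow> bool" where
  "regular_point \<sigma> p \<longleftrightarrow> \<sigma> differentiable (at p) \<and> inj (frechet_derivative \<sigma> (at p))"

definition tangent_space :: "('p::euclidean_space \<Rightarrow> 'a::euclidean_space) \<Rightarrow> 'p \<Rightarrow> 'a set" where
  "tangent_space \<sigma> p = range (frechet_derivative \<sigma> (at p))"

definition second_deriv :: "('p::euclidean_space \<Rightarrow> 'a::euclidean_space) \<Rightarrow> 'p \<Rightarrow> 'p \<Rightarrow> 'p \<Rightarrow> 'a" where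
  "second_deriv \<sigma> p v w = frechet_derivative (\<lambda>x. frechet_derivative \<sigma> (at x) v) (at p) w"

definition normal_part :: "'a::euclidean_space set \<Rightarrow> 'a \<Rightarrow> 'a" where
  "normal_part T z = (THE y. (\<forall>t\<in>T. inner y t = 0) \<and> z - y \<in> T)"

text \<open>Second fundamental form in parameter coordinates: II(d sigma v, d sigma w).\<close>
definition sff :: "('p::euclidean_space \<Rightarrow> 'a::euclidean_space) \<Rightarrow> 'p \<Rightarrow> 'p \<Rightarrow> 'p \<Rightarrow> 'a" where
  "sff \<sigma> p v w = normal_part (tangent_space \<sigma> p) (second_deriv \<sigma> p v w)"

text \<open>dim ker II, computed in parameter coordinates (d sigma_p is an isomorphism onto T_p).\<close>
definition relative_nullity :: "('p::euclidean_space \<Rightarrow> 'a::euclidean_space) \<Rightarrow> 'p \<Rightarrow> nat" where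
  "relative_nullity \<sigma> p = dim {v. \<forall>w. sff \<sigma> p v w = 0}"

definition rank_one :: "('p::euclidean_space \<Rightarrow> 'a::euclidean_space) \<Rightarrow> 'p set \<Rightarrow> bool" where
  "rank_one \<sigma> D \<longleftrightarrow> (\<forall>p\<in>D. regular_point \<sigma> p \<longrightarrow> relative_nullity \<sigma> p = DIM('p) - 1)"

definition open_interval :: "real set \<Rightarrow> bool" where
  "open_interval I \<longleftrightarrow> open I \<and> is_interval I \<and> I \<noteq> {}"

definition unit_speed_curve :: "real set \<Rightarrow> (real \<Rightarrow> 'a::euclidean_space) \<Rightarrow> bool" where
  "unit_speed_curve I \<gamma> \<longleftrightarrow> open_interval I \<and> smooth_on I \<gamma> \<and>
     (\<forall>t\<in>I. norm (vector_derivative \<gamma> (at t)) = 1)"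

text \<open>The m-1 vector fields X_1..X_{m-1} are indexed by the Basis of 'u (DIM('u) = m-1).\<close>
definition ruled_data :: "real set \<Rightarrow> (real \<Rightarrow> 'a::euclidean_space) \<Rightarrow> ('u::euclidean_space \<Rightarrow> real \<Rightarrow> 'a) \<Rightarrow> bool" where
  "ruled_data I \<gamma> X \<longleftrightarrow> unit_speed_curve I \<gamma> \<and> (\<forall>b\<in>Basis. smooth_on I (X b)) \<and>
     (\<forall>t\<in>I. \<forall>b\<in>Basis. \<forall>c\<in>Basis. inner (X b t) (X c t) = (if b = c then 1 else 0))"

definition ruled_map :: "(real \<Rightarrow> 'a::euclidean_space) \<Rightarrow> ('u::euclidean_space \<Rightarrow> real \<Rightarrow> 'a) \<Rightarrow> real \<times> 'u \<Rightarrow> 'a" where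
  "ruled_map \<gamma> X p = \<gamma> (fst p) + (\<Sum>b\<in>Basis. (snd p \<bullet> b) *\<^sub>R X b (fst p))"

definition cylinder_data :: "real set \<Rightarrow> (real \<Rightarrow> 'a::euclidean_space) \<Rightarrow> ('u::euclidean_space \<Rightarrow> 'a) \<Rightarrow> bool" where
  "cylinder_data J \<gamma> L \<longleftrightarrow> unit_speed_curve J \<gamma> \<and>
     (\<forall>b\<in>Basis. \<forall>c\<in>Basis. inner (L b) (L c) = (if b = c then 1 else 0))"

definition cylinder_map :: "(real \<Rightarrow> 'a::euclidean_space) \<Rightarrow> ('u::euclidean_space \<Rightarrow> 'a) \<Rightarrow> real \<times> 'u \<Rightarrow> 'a" where
  "cylinder_map \<gamma> L p = \<gamma> (fst p) + (\<Sum>b\<in>Basis. (snd p \<bullet> b) *\<^sub>R L b)"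

definition partials :: "('u::euclidean_space \<Rightarrow> 'a::euclidean_space) \<Rightarrow> 'u \<Rightarrow> 'a set" where
  "partials \<psi> u = (\<lambda>b. frechet_derivative \<psi> (at u) b) ` Basis"

definition cone_data :: "'u::euclidean_space set \<Rightarrow> ('u \<Rightarrow> 'a::euclidean_space) \<Rightarrow> ('u \<Rightarrow> 'a) \<Rightarrow> bool" where
  "cone_data U \<psi> Y \<longleftrightarrow> open U \<and> smooth_on U \<psi> \<and> smooth_on U Y \<and>
     (\<forall>u\<in>U. dim (partials \<psi> u) = DIM('u) - 1 \<and> norm (Y u) = 1 \<and> Y u \<notin> span (partials \<psi> u))"

text \<open>The wedge product of the partials of xi with X vanishes, i.e. these m vectors
  (d xi/d u^b for b in Basis, and X) are linearly dependent.\<close>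
definition wedge_zero :: "('u::euclidean_space \<Rightarrow> 'a::euclidean_space) \<Rightarrow> 'u \<Rightarrow> 'a \<Rightarrow> bool" where
  "wedge_zero \<xi> u Y \<longleftrightarrow> (\<exists>c0 (c::'u \<Rightarrow> real). (c0 \<noteq> 0 \<or> (\<exists>b\<in>Basis. c b \<noteq> 0)) \<and>
      c0 *\<^sub>R Y + (\<Sum>b\<in>Basis. c b *\<^sub>R frechet_derivative \<xi> (at u) b) = 0)"

definition tangent_data :: "'u::euclidean_space set \<Rightarrow> ('u \<Rightarrow> 'a::euclidean_space) \<Rightarrow> ('u \<Rightarrow> 'a) \<Rightarrow> bool" where
  "tangent_data U \<xi> Y \<longleftrightarrow> open U \<and> smooth_on U \<xi> \<and> smooth_on U Y \<and>
     (\<forall>u\<in>U. regular_point \<xi> u \<and> norm (Y u) = 1 \<and> wedge_zero \<xi> u (Y u))"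

definition line_map :: "('u::euclidean_space \<Rightarrow> 'a::euclidean_space) \<Rightarrow> ('u \<Rightarrow> 'a) \<Rightarrow> 'u \<times> real \<Rightarrow> 'a" where
  "line_map \<psi> Y p = \<psi> (fst p) + snd p *\<^sub>R Y (fst p)"

definition locally_cylinder :: "(real \<times> 'u::euclidean_space \<Rightarrow> 'a::euclidean_space) \<Rightarrow> (real \<times> 'u) set \<Rightarrow> bool" where
  "locally_cylinder \<sigma> V \<longleftrightarrow> (\<exists>J (\<gamma>::real \<Rightarrow> 'a) (L::'u \<Rightarrow> 'a) (\<phi>::real \<times> 'u \<Rightarrow> real \<times> 'u) V'.
      cylinder_data J \<gamma> L \<and> open V' \<and> V' \<subseteq> J \<times> UNIV \<and> diffeo_between V V' \<phi> \<and>
      (\<forall>x\<in>V. \<sigma> x = cylinder_map \<gamma> L (\<phi> x)))"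

definition locally_cone :: "(real \<times> 'u::euclidean_space \<Rightarrow> 'a::euclidean_space) \<Rightarrow> (real \<times> 'u) set \<Rightarrow> bool" where
  "locally_cone \<sigma> V \<longleftrightarrow> (\<exists>U (\<psi>::'u \<Rightarrow> 'a) Y (\<phi>::real \<times> 'u \<Rightarrow> 'u \<times> real) V'.
      cone_data U \<psi> Y \<and> open V' \<and> V' \<subseteq> U \<times> UNIV \<and> diffeo_between V V' \<phi> \<and>
      (\<forall>x\<in>V. \<sigma> x = line_map \<psi> Y (\<phi> x)))"

definition locally_tangent :: "(real \<times> 'u::euclidean_space \<Rightarrow> 'a::euclidean_space) \<Rightarrow> (real \<times> 'u) set \<Rightarrow> bool" where
  "locally_tangent \<sigma> V \<longleftrightarrow> (\<exists>U (\<xi>::'u \<Rightarrow> 'a) Y (\<phi>::real \<times> 'u \<Rightarrow> 'u \<times> real) V'.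
      tangent_data U \<xi> Y \<and> open V' \<and> V' \<subseteq> U \<times> UNIV \<and> diffeo_between V V' \<phi> \<and>
      (\<forall>x\<in>V. \<sigma> x = line_map \<xi> Y (\<phi> x)))"

end

theory Submission
  imports Defs
begin

text \<open>
  Let \<open>nrm t\<close> be the projection along the ruling at \<open>t\<close> onto its orthogonal complement. The second
  fundamental form vanishes on pairs of ruling directions, so rank one forces every \<open>X' b\<close> to be
  tangent at each regular point. Consequently, where some \<open>nrm t (X' c t)\<close> is nonzero, all
  \<open>nrm t (X' b t)\<close> and \<open>nrm t (\<gamma>' t)\<close> are multiples of it. If all \<open>nrm t (X' b t)\<close> vanish on an interval, the
  rulings are parallel there and the piece is cylindrical. Otherwise, near a point where
  \<open>nrm t (X' c t)\<close> is nonzero, the singular points in each ruling form a hyperplane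
  transversal to \<open>X c\<close>. Their union is parametrized by a map \<open>edge\<close> in \<open>m - 1\<close> variables whose
  differential takes values in the rulings, and every point of the submanifold lies on a line through
  an edge point in direction \<open>X c\<close>. Whether \<open>X c\<close> is in the span of the partials of \<open>edge\<close> distinguishes
  tangent submanifolds from cones; it is an open condition, decided by a single function.
\<close>

section \<open>Smooth maps\<close>

lemma C_k_has_derivative:
  assumes "C_k (Suc k) S f" "x \<in> S"
  shows "(f has_derivative frechet_derivative f (at x)) (at x)"
  using assms by (simp add: frechet_derivative_works[symmetric])

lemma C_k_lower: "C_k (Suc k) S f \<Longrightarrow> C_k k S f"
proof (induction k arbitrary: f)
  case 0
  then show ?case
    by (auto intro!: continuous_at_imp_continuous_on differentiable_imp_continuous_within)
next
  case (Suc k)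
  show ?case
    unfolding C_k.simps(2)[of k]
  proof (intro conjI allI)
    show "\<forall>x\<in>S. f differentiable at x"
      using Suc.prems by simp
    fix v
    have "C_k (Suc k) S (\<lambda>x. frechet_derivative f (at x) v)"
      using Suc.prems C_k.simps(2)[of "Suc k" S f] by blast
    then show "C_k k S (\<lambda>x. frechet_derivative f (at x) v)"
      by (rule Suc.IH)
  qed
qed

lemma C_k_subset: "C_k k S f \<Longrightarrow> T \<subseteq> S \<Longrightarrow> C_k k T f"
  by (induction k arbitrary: f) (auto intro: continuous_on_subset)

text \<open>Derivatives are local, so on an open set agreement of values passes to the directional
  derivatives and the induction can continue.\<close>

lemma C_k_cong:
  assumes "open S" "\<And>x. x \<in> S \<Longrightarrow> f x = g x" "C_k k S f"
  shows "C_k k S g"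
  using assms(2,3)
proof (induction k arbitrary: f g)
  case 0
  then show ?case by (simp cong: continuous_on_cong)
next
  case (Suc k)
  have g: "(g has_derivative frechet_derivative f (at x)) (at x)" if "x \<in> S" for x
    using C_k_has_derivative[OF Suc.prems(2) that] assms(1) that Suc.prems(1)
    by (rule has_derivative_transform_within_open)
  have "C_k k S (\<lambda>x. frechet_derivative g (at x) v)" for v
  proof (rule Suc.IH)
    show "C_k k S (\<lambda>x. frechet_derivative f (at x) v)"
      using Suc.prems by simp
  qed (simp add: frechet_derivative_at[OF g])
  then show ?case
    using g by (auto simp: differentiable_def)
qed

text \<open>\<open>C_k\<close> is phrased through \<open>frechet_derivative\<close>; by uniqueness
  of the derivative any explicit formula may replace it. The differentiation rules below enter
  through this rule.\<close>

lemma C_k_SucI: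
  assumes "open S" "\<And>x. x \<in> S \<Longrightarrow> (f has_derivative f' x) (at x)" "\<And>v. C_k k S (\<lambda>x. f' x v)"
  shows "C_k (Suc k) S f"
proof -
  have "C_k k S (\<lambda>x. frechet_derivative f (at x) v)" for v
    by (rule C_k_cong[OF assms(1) _ assms(3)[of v]]) (simp add: frechet_derivative_at[OF assms(2)])
  then show ?thesis
    using assms(2) by (auto simp: differentiable_def)
qed

lemma C_k_const: "open S \<Longrightarrow> C_k k S (\<lambda>x. c)"
proof (induction k arbitrary: c)
  case (Suc k)
  show ?case
    by (rule C_k_SucI[where f' = "\<lambda>_ _. 0"]) (use Suc in auto)
qed simp

lemma C_k_add:
  "open S \<Longrightarrow> C_k k S f \<Longrightarrow> C_k k S g \<Longrightarrow> C_k k S (\<lambda>x. f x + g x)"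
proof (induction k arbitrary: f g)
  case 0
  then show ?case by (simp add: continuous_on_add)
next
  case (Suc k)
  show ?case
    by (rule C_k_SucI[OF Suc.prems(1) has_derivative_add[OF
            C_k_has_derivative[OF Suc.prems(2)] C_k_has_derivative[OF Suc.prems(3)]]])
      (use Suc in auto)
qed

lemma C_k_linear_compose:
  "bounded_linear L \<Longrightarrow> open S \<Longrightarrow> C_k k S f \<Longrightarrow> C_k k S (\<lambda>x. L (f x))"
proof (induction k arbitrary: f)
  case 0
  then show ?case by (simp add: bounded_linear.continuous_on)
next
  case (Suc k)
  show ?case
    by (rule C_k_SucI[OF Suc.prems(2) bounded_linear.has_derivative[OF Suc.prems(1)
            C_k_has_derivative[OF Suc.prems(3)]]])
      (use Suc in auto)
qed

lemma C_k_linear: "bounded_linear L \<Longrightarrow> open S \<Longrightarrow> C_k k S L"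
proof (cases k)
  case 0
  assume "bounded_linear L"
  with 0 show ?thesis by (simp add: linear_continuous_on)
next
  case (Suc j)
  assume "bounded_linear L" "open S"
  then show ?thesis
    unfolding Suc by (intro C_k_SucI[where f' = "\<lambda>_. L"] C_k_const bounded_linear_imp_has_derivative)
qed

lemma C_k_bilinear:
  assumes "bounded_bilinear B" "open S"
  shows "C_k k S f \<Longrightarrow> C_k k S g \<Longrightarrow> C_k k S (\<lambda>x. B (f x) (g x))"
proof (induction k arbitrary: f g)
  case 0
  then show ?case using assms by (simp add: bounded_bilinear.continuous_on)
next
  case (Suc k)
  show ?case
  proof (rule C_k_SucI[OF assms(2) bounded_bilinear.FDERIV[OF assms(1)
            C_k_has_derivative[OF Suc.prems(1)] C_k_has_derivative[OF Suc.prems(2)]]])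
    fix v
    show "C_k k S (\<lambda>x. B (f x) (frechet_derivative g (at x) v) + B (frechet_derivative f (at x) v) (g x))"
      using Suc.prems by (intro C_k_add[OF assms(2)] Suc.IH C_k_lower[OF Suc.prems(1)]
          C_k_lower[OF Suc.prems(2)]) simp_all
  qed
qed

lemma C_k_sum:
  assumes "open S" "\<And>i. i \<in> A \<Longrightarrow> C_k k S (f i)"
  shows "C_k k S (\<lambda>x. \<Sum>i\<in>A. f i x)"
  using assms(2)
  by (induction A rule: infinite_finite_induct) (simp_all add: C_k_const C_k_add assms(1))

lemma C_k_compose:
  assumes "open S" "open T" "g ` S \<subseteq> T"
  shows "C_k k T f \<Longrightarrow> C_k k S g \<Longrightarrow> C_k k S (\<lambda>x. f (g x))"
proof (induction k arbitrary: f)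
  case 0
  then show ?case using assms(3) by (auto intro: continuous_on_compose2)
next
  case (Suc k)
  \<comment> \<open>In the chain rule the linear map and its argument both vary with
    \<open>x\<close>, while \<open>C_k\<close> controls derivatives in a fixed direction. Expanding
    over \<open>Basis\<close> gives products of coordinates of the derivative of \<open>g\<close>
    with partials of \<open>f\<close> composed with \<open>g\<close>, to which the induction
    hypothesis applies.\<close>
  have der: "((\<lambda>x. f (g x)) has_derivative
      (\<lambda>v. \<Sum>b\<in>Basis. (frechet_derivative g (at x) v \<bullet> b) *\<^sub>R frechet_derivative f (at (g x)) b)) (at x)"
    if "x \<in> S" for x
  proof -
    have f: "(f has_derivative frechet_derivative f (at (g x))) (at (g x))"
      using C_k_has_derivative[OF Suc.prems(1)] that assms(3) by blast
    interpret lin: linear "frechet_derivative f (at (g x))"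
      using f has_derivative_linear by blast
    have "frechet_derivative f (at (g x)) w = (\<Sum>b\<in>Basis. (w \<bullet> b) *\<^sub>R frechet_derivative f (at (g x)) b)" for w
      by (subst euclidean_representation[of w, symmetric]) (simp only: lin.sum lin.scale)
    then have "(\<lambda>v. frechet_derivative f (at (g x)) (frechet_derivative g (at x) v)) =
        (\<lambda>v. \<Sum>b\<in>Basis. (frechet_derivative g (at x) v \<bullet> b) *\<^sub>R frechet_derivative f (at (g x)) b)"
      by (intro ext)
    then show ?thesis
      by (rule has_derivative_eq_rhs[OF has_derivative_compose[OF C_k_has_derivative[OF Suc.prems(2) that] f]])
  qed
  show ?case
  proof (rule C_k_SucI[OF assms(1) der])
    fix v
    have "C_k k S (\<lambda>x. (frechet_derivative g (at x) v \<bullet> b) *\<^sub>R frechet_derivative f (at (g x)) b)" for b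
      using Suc.prems
      by (intro C_k_bilinear[OF bounded_bilinear_scaleR assms(1)]
          C_k_linear_compose[OF bounded_linear_inner_left assms(1)] Suc.IH C_k_lower[OF Suc.prems(2)]) simp_all
    then show "C_k k S (\<lambda>x. \<Sum>b\<in>Basis. (frechet_derivative g (at x) v \<bullet> b) *\<^sub>R frechet_derivative f (at (g x)) b)"
      by (rule C_k_sum[OF assms(1)])
  qed
qed

text \<open>The derivative of the reciprocal is again built from the reciprocal, which the induction
  hypothesis covers one level down.\<close>

lemma C_k_inverse:
  fixes f :: "'a::euclidean_space \<Rightarrow> real"
  assumes "open S" "\<And>x. x \<in> S \<Longrightarrow> f x \<noteq> 0"
  shows "C_k k S f \<Longrightarrow> C_k k S (\<lambda>x. inverse (f x))"
proof (induction k)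
  case 0
  then show ?case using assms(2) by (simp add: continuous_on_inverse)
next
  case (Suc k)
  show ?case
  proof (rule C_k_SucI[OF assms(1)])
    fix x assume "x \<in> S"
    then show "((\<lambda>x. inverse (f x)) has_derivative
        (\<lambda>v. - (inverse (f x) * frechet_derivative f (at x) v * inverse (f x)))) (at x)"
      using C_k_has_derivative[OF Suc.prems] assms(2) by (intro Deriv.has_derivative_inverse) auto
  next
    fix v
    show "C_k k S (\<lambda>x. - (inverse (f x) * frechet_derivative f (at x) v * inverse (f x)))"
      using Suc.prems
      by (intro C_k_linear_compose[OF bounded_linear_minus[OF bounded_linear_ident] assms(1)]
          C_k_bilinear[OF bounded_bilinear_mult assms(1)] Suc.IH C_k_lower[OF Suc.prems]) simp_all
  qed
qed

section \<open>Closure rules for smooth maps\<close>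

named_theorems smooth_intros

lemma smooth_on_open: "smooth_on S f \<Longrightarrow> open S"
  by (simp add: smooth_on_def)

lemma smooth_on_subset: "smooth_on S f \<Longrightarrow> open T \<Longrightarrow> T \<subseteq> S \<Longrightarrow> smooth_on T f"
  by (auto simp: smooth_on_def intro: C_k_subset)

lemma smooth_on_cong: "smooth_on S f \<Longrightarrow> (\<And>x. x \<in> S \<Longrightarrow> f x = g x) \<Longrightarrow> smooth_on S g"
  by (auto simp: smooth_on_def intro: C_k_cong[of S f g])

lemma smooth_on_continuous: "smooth_on S f \<Longrightarrow> continuous_on S f"
  unfolding smooth_on_def by (metis C_k.simps(1))

lemma smooth_on_has_derivative:
  "smooth_on S f \<Longrightarrow> x \<in> S \<Longrightarrow> (f has_derivative frechet_derivative f (at x)) (at x)"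
  unfolding smooth_on_def using C_k_has_derivative by blast

lemma smooth_on_frechet_derivative: "smooth_on S f \<Longrightarrow> smooth_on S (\<lambda>x. frechet_derivative f (at x) v)"
  unfolding smooth_on_def by (metis C_k.simps(2))

lemma smooth_on_const [smooth_intros]: "open S \<Longrightarrow> smooth_on S (\<lambda>x. c)"
  by (simp add: smooth_on_def C_k_const)

lemma smooth_on_linear: "bounded_linear L \<Longrightarrow> open S \<Longrightarrow> smooth_on S L"
  by (simp add: smooth_on_def C_k_linear)

lemma smooth_on_ident [smooth_intros]: "open S \<Longrightarrow> smooth_on S (\<lambda>x. x)"
  by (rule smooth_on_linear[OF bounded_linear_ident])

lemma smooth_on_linear_compose:
  "bounded_linear L \<Longrightarrow> smooth_on S f \<Longrightarrow> smooth_on S (\<lambda>x. L (f x))"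
  by (simp add: smooth_on_def C_k_linear_compose)

lemma smooth_on_fst [smooth_intros]: "smooth_on S f \<Longrightarrow> smooth_on S (\<lambda>x. fst (f x))"
  by (rule smooth_on_linear_compose[OF bounded_linear_fst])

lemma smooth_on_snd [smooth_intros]: "smooth_on S f \<Longrightarrow> smooth_on S (\<lambda>x. snd (f x))"
  by (rule smooth_on_linear_compose[OF bounded_linear_snd])

lemma smooth_on_uminus [smooth_intros]: "smooth_on S f \<Longrightarrow> smooth_on S (\<lambda>x. - f x)"
  by (rule smooth_on_linear_compose[OF bounded_linear_minus[OF bounded_linear_ident]])

lemma smooth_on_add [smooth_intros]:
  "smooth_on S f \<Longrightarrow> smooth_on S g \<Longrightarrow> smooth_on S (\<lambda>x. f x + g x)"
  by (simp add: smooth_on_def C_k_add)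

lemma smooth_on_diff [smooth_intros]:
  "smooth_on S f \<Longrightarrow> smooth_on S g \<Longrightarrow> smooth_on S (\<lambda>x. f x - g x)"
  using smooth_on_add[of S f "\<lambda>x. - g x"] smooth_on_uminus by fastforce

lemma smooth_on_scaleR [smooth_intros]:
  "smooth_on S f \<Longrightarrow> smooth_on S g \<Longrightarrow> smooth_on S (\<lambda>x. f x *\<^sub>R g x)"
  by (simp add: smooth_on_def C_k_bilinear[OF bounded_bilinear_scaleR])

lemma smooth_on_mult [smooth_intros]:
  fixes f :: "_ \<Rightarrow> 'a::real_normed_algebra"
  shows "smooth_on S f \<Longrightarrow> smooth_on S g \<Longrightarrow> smooth_on S (\<lambda>x. f x * g x)"
  by (simp add: smooth_on_def C_k_bilinear[OF bounded_bilinear_mult])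

lemma smooth_on_inner [smooth_intros]:
  "smooth_on S f \<Longrightarrow> smooth_on S g \<Longrightarrow> smooth_on S (\<lambda>x. f x \<bullet> g x)"
  by (simp add: smooth_on_def C_k_bilinear[OF bounded_bilinear_inner])

lemma smooth_on_sum [smooth_intros]:
  assumes "open S" "\<And>i. i \<in> A \<Longrightarrow> smooth_on S (f i)"
  shows "smooth_on S (\<lambda>x. \<Sum>i\<in>A. f i x)"
  using assms by (simp add: smooth_on_def C_k_sum)

lemma smooth_on_divide [smooth_intros]:
  fixes f g :: "_ \<Rightarrow> real"
  assumes "smooth_on S f" "smooth_on S g" "\<And>x. x \<in> S \<Longrightarrow> g x \<noteq> 0"
  shows "smooth_on S (\<lambda>x. f x / g x)"
  unfolding divide_inverse
  using assms by (intro smooth_on_mult) (auto simp: smooth_on_def intro: C_k_inverse)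

lemma smooth_on_Pair [smooth_intros]:
  assumes "smooth_on S f" "smooth_on S g"
  shows "smooth_on S (\<lambda>x. (f x, g x))"
proof -
  have "smooth_on S (\<lambda>x. (f x, 0) + (0, g x))"
    using assms
    by (intro smooth_on_add smooth_on_linear_compose[OF bounded_linear_Pair[OF bounded_linear_ident bounded_linear_zero]]
        smooth_on_linear_compose[OF bounded_linear_Pair[OF bounded_linear_zero bounded_linear_ident]])
  then show ?thesis by simp
qed

lemma smooth_on_compose:
  "smooth_on T f \<Longrightarrow> smooth_on S g \<Longrightarrow> g ` S \<subseteq> T \<Longrightarrow> smooth_on S (\<lambda>x. f (g x))"
  unfolding smooth_on_def using C_k_compose by blast

lemma smooth_on_has_vector_derivative:
  "smooth_on S f \<Longrightarrow> t \<in> S \<Longrightarrow> (f has_vector_derivative vector_derivative f (at t)) (at t)"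
  using smooth_on_has_derivative by (blast intro: differentiableI_vector
      vector_derivative_works[THEN iffD1] differentiableI)

lemma smooth_on_vector_derivative:
  assumes "smooth_on S f"
  shows "smooth_on S (\<lambda>t. vector_derivative f (at t))"
proof (rule smooth_on_cong[OF smooth_on_frechet_derivative[OF assms, of 1]])
  fix t assume "t \<in> S"
  have "(\<lambda>h. h *\<^sub>R vector_derivative f (at t)) = frechet_derivative f (at t)"
    using smooth_on_has_vector_derivative[OF assms \<open>t \<in> S\<close>]
    unfolding has_vector_derivative_def by (rule frechet_derivative_at)
  from fun_cong[OF this, of 1] show "frechet_derivative f (at t) 1 = vector_derivative f (at t)"
    by simp
qed

text \<open>\<open>\<theta>\<close> is an explicit smooth inverse of \<open>\<phi>\<close>. The
  image of \<open>V\<close> is the preimage of \<open>V\<close> under \<open>\<theta>\<close> within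
  \<open>D'\<close>, hence open, and on it \<open>inv_into V \<phi>\<close> agrees with
  \<open>\<theta>\<close>.\<close>

lemma diffeo_between_restrict:
  assumes "smooth_on D \<phi>" "smooth_on D' \<theta>" "\<And>x. x \<in> D \<Longrightarrow> \<phi> x \<in> D'"
    and "\<And>x. x \<in> D \<Longrightarrow> \<theta> (\<phi> x) = x" "\<And>y. y \<in> D' \<Longrightarrow> \<phi> (\<theta> y) = y"
    and "open V" "V \<subseteq> D"
  shows "open (\<phi> ` V)" "diffeo_between V (\<phi> ` V) \<phi>"
proof -
  have "\<phi> ` V = \<theta> -` V \<inter> D'"
    using assms(3-5,7) by (auto simp: subset_iff) (metis imageI)
  then show op: "open (\<phi> ` V)"
    using continuous_on_open_vimage[OF smooth_on_open[OF assms(2)]] smooth_on_continuous[OF assms(2)] \<open>open V\<close>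
    by metis
  have inj: "inj_on \<phi> V"
    using assms(4,7) by (metis inj_on_def subsetD)
  have "smooth_on (\<phi> ` V) (inv_into V \<phi>)"
  proof (rule smooth_on_cong[OF smooth_on_subset[OF assms(2) op]])
    show "\<phi> ` V \<subseteq> D'"
      using assms(3,7) by auto
    show "\<theta> y = inv_into V \<phi> y" if "y \<in> \<phi> ` V" for y
      using that inj assms(4,7) by (auto simp: inv_into_f_f)
  qed
  then show "diffeo_between V (\<phi> ` V) \<phi>"
    using inj smooth_on_subset[OF assms(1,6,7)] by (simp add: diffeo_between_def)
qed

section \<open>Ruled submanifolds\<close>

text \<open>Orthogonal decomposition along \<open>T\<close> exists and is unique, so the description
  in \<open>normal_part\<close> denotes the normal component; if that is zero, only the component in
  \<open>T\<close> remains.\<close>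

lemma normal_part_eq_0_imp_mem:
  assumes "subspace T" "normal_part T z = 0"
  shows "z \<in> T"
proof -
  obtain y w where yw: "y \<in> T" "\<And>t. t \<in> T \<Longrightarrow> orthogonal w t" "z = y + w"
    using orthogonal_subspace_decomp_exists[of T z] assms(1) by (metis span_eq_iff)
  have uniq: "w' = w" if "\<forall>t\<in>T. inner w' t = 0" "z - w' \<in> T" for w'
  proof -
    have "w' - w = y - (z - w')"
      using yw(3) by simp
    then have "w' - w \<in> T"
      using subspace_diff[OF assms(1) yw(1) that(2)] by metis
    then have "(w' - w) \<bullet> (w' - w) = 0"
      using that(1) yw(2) by (simp add: inner_diff_left orthogonal_def)
    then show ?thesis by simp
  qed
  have "normal_part T z = w"
    unfolding normal_part_def
    by (rule the_equality) (use yw uniq in \<open>auto simp: orthogonal_def\<close>)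
  then show ?thesis
    using assms(2) yw by simp
qed

section \<open>Frame, differential and second derivatives of a ruled map\<close>

locale ruled_submanifold =
  fixes I :: "real set"
    and \<gamma> :: "real \<Rightarrow> 'a::euclidean_space"
    and X :: "'u::euclidean_space \<Rightarrow> real \<Rightarrow> 'a"
  assumes ruled: "ruled_data I \<gamma> X"
begin

abbreviation \<gamma>' :: "real \<Rightarrow> 'a" where
  "\<gamma>' t \<equiv> vector_derivative \<gamma> (at t)"

abbreviation X' :: "'u \<Rightarrow> real \<Rightarrow> 'a" where
  "X' b t \<equiv> vector_derivative (X b) (at t)"

definition ruling :: "real \<Rightarrow> 'u \<Rightarrow> 'a" where
  "ruling t v = (\<Sum>b\<in>Basis. (v \<bullet> b) *\<^sub>R X b t)"

text \<open>The partial derivative of \<open>ruled_map\<close> in the curve parameter at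
  \<open>(t, u)\<close>.\<close>

definition velocity :: "real \<Rightarrow> 'u \<Rightarrow> 'a" where
  "velocity t u = \<gamma>' t + (\<Sum>b\<in>Basis. (u \<bullet> b) *\<^sub>R X' b t)"

definition nrm :: "real \<Rightarrow> 'a \<Rightarrow> 'a" where
  "nrm t z = z - (\<Sum>b\<in>Basis. (z \<bullet> X b t) *\<^sub>R X b t)"

lemma open_I: "open I" and smooth_\<gamma>: "smooth_on I \<gamma>"
  and smooth_X: "b \<in> Basis \<Longrightarrow> smooth_on I (X b)"
  and unit_speed: "t \<in> I \<Longrightarrow> norm (\<gamma>' t) = 1"
  and orthonormal: "t \<in> I \<Longrightarrow> b \<in> Basis \<Longrightarrow> c \<in> Basis \<Longrightarrow> X b t \<bullet> X c t = (if b = c then 1 else 0)"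
  using ruled by (auto simp: ruled_data_def unit_speed_curve_def open_interval_def)

lemma \<gamma>_deriv: "t \<in> I \<Longrightarrow> (\<gamma> has_vector_derivative \<gamma>' t) (at t)"
  by (rule smooth_on_has_vector_derivative[OF smooth_\<gamma>])

lemma X_deriv: "b \<in> Basis \<Longrightarrow> t \<in> I \<Longrightarrow> (X b has_vector_derivative X' b t) (at t)"
  by (rule smooth_on_has_vector_derivative[OF smooth_X])

lemma ruled_map_eq: "ruled_map \<gamma> X p = \<gamma> (fst p) + ruling (fst p) (snd p)"
  by (simp add: ruled_map_def ruling_def)

lemma linear_ruling: "linear (ruling t)"
  by (rule linearI) (simp_all add: ruling_def inner_add_left scaleR_add_left sum.distrib scaleR_sum_right)

lemma ruling_Basis: "b \<in> Basis \<Longrightarrow> ruling t b = X b t"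
  by (simp add: ruling_def inner_Basis if_distrib[of "\<lambda>r. r *\<^sub>R _"] cong: if_cong)

lemma ruling_inner: "t \<in> I \<Longrightarrow> b \<in> Basis \<Longrightarrow> ruling t v \<bullet> X b t = v \<bullet> b"
  by (simp add: ruling_def inner_sum_left orthonormal if_distrib[of "(*) _"] cong: if_cong)

lemma ruling_in_span: "ruling t v \<in> span ((\<lambda>b. X b t) ` Basis)"
  unfolding ruling_def by (intro span_sum span_scale span_base) auto

lemma linear_nrm: "linear (nrm t)"
  by (rule linearI) (simp_all add: nrm_def inner_add_left scaleR_add_left sum.distrib scaleR_sum_right
      scaleR_diff_right)

lemma nrm_ruling: "t \<in> I \<Longrightarrow> nrm t (ruling t v) = 0"
  by (simp add: nrm_def ruling_inner) (simp add: ruling_def)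

lemma nrm_X: "t \<in> I \<Longrightarrow> b \<in> Basis \<Longrightarrow> nrm t (X b t) = 0"
  using nrm_ruling[of t b] by (simp add: ruling_Basis)

lemma nrm_inner_X: "t \<in> I \<Longrightarrow> b \<in> Basis \<Longrightarrow> nrm t z \<bullet> X b t = 0"
  by (simp add: nrm_def inner_diff_left inner_sum_left orthonormal if_distrib[of "(*) _"] cong: if_cong)

lemma nrm_inner_nrm: "t \<in> I \<Longrightarrow> nrm t z \<bullet> nrm t w = z \<bullet> nrm t w"
proof -
  assume "t \<in> I"
  then have "(\<Sum>b\<in>Basis. (z \<bullet> X b t) *\<^sub>R X b t) \<bullet> nrm t w = 0"
    using nrm_inner_X by (simp add: inner_sum_left inner_commute[of "X _ t"])
  then show ?thesis
    by (simp add: nrm_def[of t z] inner_diff_left)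
qed

lemma nrm_eq_0_iff: 
  assumes "t \<in> I"
  shows "nrm t z = 0 \<longleftrightarrow> z \<in> span ((\<lambda>b. X b t) ` Basis)"
proof
  assume "nrm t z = 0"
  then have "z = (\<Sum>b\<in>Basis. (z \<bullet> X b t) *\<^sub>R X b t)"
    by (simp add: nrm_def)
  also have "\<dots> \<in> span ((\<lambda>b. X b t) ` Basis)"
    by (intro span_sum span_scale span_base) auto
  finally show "z \<in> span ((\<lambda>b. X b t) ` Basis)" .
next
  interpret linear "nrm t" by (rule linear_nrm)
  assume "z \<in> span ((\<lambda>b. X b t) ` Basis)"
  then show "nrm t z = 0"
    by (induction rule: span_induct_alt) (auto simp: add scale nrm_X assms)
qed

lemma dim_ruling_basis:
  assumes "t \<in> I"
  shows "dim ((\<lambda>b. X b t) ` Basis) = DIM('u)"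
proof -
  have ne: "X b t \<noteq> 0" if "b \<in> Basis" for b
    using orthonormal[OF assms that that] by auto
  have inj: "inj_on (\<lambda>b. X b t) Basis"
  proof (rule inj_onI, rule ccontr)
    fix b c :: 'u
    assume "b \<in> Basis" "c \<in> Basis" "X b t = X c t" "b \<noteq> c"
    then show False
      using orthonormal[OF assms, of b c] orthonormal[OF assms, of c c] by simp
  qed
  have "pairwise orthogonal ((\<lambda>b. X b t) ` Basis)"
    using orthonormal[OF assms] by (auto simp: pairwise_def orthogonal_def)
  then have "independent ((\<lambda>b. X b t) ` Basis)"
    by (rule pairwise_orthogonal_independent) (use ne in auto)
  then show ?thesis
    by (simp add: dim_eq_card_independent card_image[OF inj])
qed

lemma ruled_map_has_derivative:
  assumes "t \<in> I"
  shows "(ruled_map \<gamma> X has_derivative (\<lambda>v. fst v *\<^sub>R velocity t u + ruling t (snd v))) (at (t, u))"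
proof -
  have c: "((\<lambda>p. f (fst p)) has_derivative (\<lambda>v. fst v *\<^sub>R d)) (at (t, u))"
    if "(f has_vector_derivative d) (at t)" for f :: "real \<Rightarrow> 'a" and d
    using has_derivative_compose[OF has_derivative_fst[OF has_derivative_ident], of f _ "(t, u)"] that
    by (simp add: has_vector_derivative_def)
  show ?thesis
    unfolding ruled_map_def[abs_def]
    by (rule has_derivative_eq_rhs)
      (auto intro!: derivative_eq_intros c \<gamma>_deriv X_deriv assms
        simp: velocity_def ruling_def fun_eq_iff scaleR_add_right scaleR_sum_right sum.distrib algebra_simps)
qed

lemma frechet_ruled_map:
  assumes "p \<in> I \<times> UNIV"
  shows "frechet_derivative (ruled_map \<gamma> X) (at p) =
    (\<lambda>v. fst v *\<^sub>R velocity (fst p) (snd p) + ruling (fst p) (snd v))"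
  using frechet_derivative_at[OF ruled_map_has_derivative[of "fst p" "snd p"]] assms by auto

text \<open>These are the directions on which rank one will be tested. As the map is affine along
  rulings, differentiating in a ruling direction \<open>b\<close> sees only the curve component of
  \<open>v\<close>.\<close>

lemma second_deriv_ruled_map:
  assumes "t \<in> I"
  shows "second_deriv (ruled_map \<gamma> X) (t, u) v (1, 0) =
      fst v *\<^sub>R (vector_derivative \<gamma>' (at t) + (\<Sum>b\<in>Basis. (u \<bullet> b) *\<^sub>R vector_derivative (X' b) (at t)))
        + (\<Sum>b\<in>Basis. (snd v \<bullet> b) *\<^sub>R X' b t)"
    and "b \<in> Basis \<Longrightarrow> second_deriv (ruled_map \<gamma> X) (t, u) v (0, b) = fst v *\<^sub>R X' b t"
proof -
  have c: "((\<lambda>p. f (fst p)) has_derivative (\<lambda>v. fst v *\<^sub>R vector_derivative f (at t))) (at (t, u))"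
    if "smooth_on I f" for f :: "real \<Rightarrow> 'a"
    using has_derivative_compose[OF has_derivative_fst[OF has_derivative_ident], of f _ "(t, u)"]
      smooth_on_has_vector_derivative[OF that assms]
    by (simp add: has_vector_derivative_def)
  let ?G = "vector_derivative \<gamma>' (at t) + (\<Sum>b\<in>Basis. (u \<bullet> b) *\<^sub>R vector_derivative (X' b) (at t))"
  let ?d = "\<lambda>w. fst v *\<^sub>R (fst w *\<^sub>R ?G + (\<Sum>b\<in>Basis. (snd w \<bullet> b) *\<^sub>R X' b t))
      + fst w *\<^sub>R (\<Sum>b\<in>Basis. (snd v \<bullet> b) *\<^sub>R X' b t)"
  have "((\<lambda>p. fst v *\<^sub>R velocity (fst p) (snd p) + ruling (fst p) (snd v)) has_derivative ?d) (at (t, u))"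
    unfolding velocity_def ruling_def
    by (rule has_derivative_eq_rhs)
      (auto intro!: derivative_eq_intros c smooth_X smooth_\<gamma> smooth_on_vector_derivative
        simp: fun_eq_iff scaleR_add_right scaleR_sum_right sum.distrib algebra_simps)
  then have "((\<lambda>p. frechet_derivative (ruled_map \<gamma> X) (at p) v) has_derivative ?d) (at (t, u))"
    by (rule has_derivative_transform_within_open[OF _ open_Times[OF open_I open_UNIV]])
      (use assms in \<open>auto simp: frechet_ruled_map\<close>)
  then have *: "second_deriv (ruled_map \<gamma> X) (t, u) v = ?d"
    unfolding second_deriv_def by (simp add: frechet_derivative_at[symmetric])
  show "second_deriv (ruled_map \<gamma> X) (t, u) v (1, 0) = fst v *\<^sub>R ?G + (\<Sum>b\<in>Basis. (snd v \<bullet> b) *\<^sub>R X' b t)"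
    unfolding * by simp
  show "second_deriv (ruled_map \<gamma> X) (t, u) v (0, b) = fst v *\<^sub>R X' b t" if "b \<in> Basis"
    unfolding * using that by (simp add: inner_Basis if_distrib[of "\<lambda>r. r *\<^sub>R _"] cong: if_cong)
qed

text \<open>The velocity is transversal to the ruling. \<open>nrm t\<close> kills the ruling part of
  the differential and so detects the curve component of a kernel vector; inner products with the
  frame detect the rest.\<close>

lemma regular_point_ruled_map:
  assumes "t \<in> I" "nrm t (velocity t u) \<noteq> 0"
  shows "regular_point (ruled_map \<gamma> X) (t, u)"
proof -
  interpret N: linear "nrm t" by (rule linear_nrm)
  interpret R: linear "ruling t" by (rule linear_ruling)
  let ?F = "\<lambda>v::real \<times> 'u. fst v *\<^sub>R velocity t u + ruling t (snd v)"
  have F: "(ruled_map \<gamma> X has_derivative ?F) (at (t, u))"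
    by (rule ruled_map_has_derivative[OF assms(1)])
  have "v = 0" if "?F v = 0" for v
  proof -
    have "nrm t (?F v) = fst v *\<^sub>R nrm t (velocity t u)"
      by (simp add: N.add N.scale nrm_ruling assms(1))
    then have 0: "fst v = 0"
      using that assms(2) by (simp add: N.zero)
    then have "snd v \<bullet> b = 0" if "b \<in> Basis" for b
      using \<open>?F v = 0\<close> ruling_inner[OF assms(1) that, of "snd v"] by simp
    then have "snd v = 0"
      using euclidean_all_zero_iff by blast
    then show ?thesis
      using 0 by (simp add: prod_eq_iff)
  qed
  then have "inj ?F"
    using linear_injective_0[OF has_derivative_linear[OF F]] by blast
  then show ?thesis
    using F frechet_derivative_at[OF F] by (auto simp: regular_point_def differentiable_def)
qed

lemma smooth_ruled_map: "smooth_on (I \<times> UNIV) (ruled_map \<gamma> X)"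
proof -
  have op: "open (I \<times> (UNIV :: 'u set))"
    by (intro open_Times open_I open_UNIV)
  have "smooth_on (I \<times> (UNIV :: 'u set)) (\<lambda>p. f (fst p))" if "smooth_on I f" for f :: "real \<Rightarrow> 'a"
    by (rule smooth_on_compose[OF that]) (auto intro: smooth_on_linear bounded_linear_fst op)
  note c = this
  show ?thesis
    unfolding ruled_map_def[abs_def]
    by (intro smooth_intros op c smooth_\<gamma> smooth_X smooth_on_linear bounded_linear_snd)
qed

lemma smooth_nrm:
  assumes "J \<subseteq> I" "smooth_on J f"
  shows "smooth_on J (\<lambda>t. nrm t (f t))"
  unfolding nrm_def
  by (intro smooth_intros assms(2) smooth_on_open[OF assms(2)] smooth_on_subset[OF smooth_X _ assms(1)])

subsection \<open>Parallel rulings\<close>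

lemma X_inner_X'_antisym:
  assumes "t \<in> I" "b \<in> Basis" "c \<in> Basis"
  shows "X' b t \<bullet> X c t = - (X b t \<bullet> X' c t)"
proof -
  have "((\<lambda>t. X b t \<bullet> X c t) has_vector_derivative X b t \<bullet> X' c t + X' b t \<bullet> X c t) (at t)"
    using bounded_bilinear.has_vector_derivative[OF bounded_bilinear_inner
        X_deriv[OF assms(2,1)] X_deriv[OF assms(3,1)]] by simp
  moreover have "((\<lambda>t. X b t \<bullet> X c t) has_vector_derivative 0) (at t)"
    by (rule has_vector_derivative_transform_within_open[OF has_vector_derivative_const open_I assms(1)])
      (simp add: orthonormal assms)
  ultimately show ?thesis
    using vector_derivative_unique_at by fastforce
qed

text \<open>The derivative of the projection onto the ruling vanishes, because the matrix
  of the \<open>X' b\<close> in the frame \<open>X\<close> is antisymmetric.\<close>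

lemma ruling_projection_constant:
  assumes J: "J \<subseteq> I" "open J" "convex J" and par: "\<And>t b. t \<in> J \<Longrightarrow> b \<in> Basis \<Longrightarrow> nrm t (X' b t) = 0"
    and st: "s \<in> J" "t \<in> J"
  shows "(\<Sum>b\<in>Basis. (z \<bullet> X b s) *\<^sub>R X b s) = (\<Sum>b\<in>Basis. (z \<bullet> X b t) *\<^sub>R X b t)"
proof -
  let ?P = "\<lambda>t. \<Sum>b\<in>Basis. (z \<bullet> X b t) *\<^sub>R X b t"
  have der: "(?P has_vector_derivative 0) (at t within J)" if "t \<in> J" for t
  proof -
    have t: "t \<in> I" using that J(1) by blast
    define w where "w b c = X' b t \<bullet> X c t" for b c
    have X': "X' b t = (\<Sum>c\<in>Basis. w b c *\<^sub>R X c t)" if "b \<in> Basis" for b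
      using par[OF \<open>t \<in> J\<close> that] by (simp add: nrm_def w_def)
    have anti: "w b c = - w c b" if "b \<in> Basis" "c \<in> Basis" for b c
      using X_inner_X'_antisym[OF t that] by (simp add: w_def inner_commute)
    have "(?P has_vector_derivative (\<Sum>b\<in>Basis. (z \<bullet> X b t) *\<^sub>R X' b t + (z \<bullet> X' b t) *\<^sub>R X b t)) (at t)"
      by (intro has_vector_derivative_sum bounded_bilinear.has_vector_derivative[OF bounded_bilinear_scaleR]
          bounded_linear.has_vector_derivative[OF bounded_linear_inner_right] X_deriv t)
    moreover have "(\<Sum>b\<in>Basis. (z \<bullet> X' b t) *\<^sub>R X b t) = - (\<Sum>b\<in>Basis. (z \<bullet> X b t) *\<^sub>R X' b t)"
    proof -
      have "(\<Sum>b\<in>Basis. (z \<bullet> X' b t) *\<^sub>R X b t) = (\<Sum>b\<in>Basis. \<Sum>c\<in>Basis. (w b c * (z \<bullet> X c t)) *\<^sub>R X b t)"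
        by (simp add: X' inner_sum_right scaleR_sum_left)
      also have "\<dots> = (\<Sum>c\<in>Basis. \<Sum>b\<in>Basis. (w b c * (z \<bullet> X c t)) *\<^sub>R X b t)"
        by (rule sum.swap)
      also have "\<dots> = (\<Sum>c\<in>Basis. \<Sum>b\<in>Basis. - ((z \<bullet> X c t) *\<^sub>R (w c b *\<^sub>R X b t)))"
        by (intro sum.cong refl) (subst anti, auto simp: mult.commute)
      also have "\<dots> = - (\<Sum>b\<in>Basis. (z \<bullet> X b t) *\<^sub>R X' b t)"
        by (simp add: X' scaleR_sum_right sum_negf)
      finally show ?thesis .
    qed
    ultimately show ?thesis
      by (simp add: sum.distrib has_vector_derivative_at_within)
  qed
  then obtain c where "\<And>t. t \<in> J \<Longrightarrow> ?P t = c"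
    using has_vector_derivative_zero_constant[OF J(3) der] by blast
  then show ?thesis
    using st by simp
qed

text \<open>All rulings over \<open>J\<close> have the same direction space. The curve is kept, the
  frame is frozen at one parameter \<open>s\<close>, and only the ruling coordinates are changed,
  separately for each \<open>t\<close>.\<close>

lemma locally_cylinder_if_parallel:
  assumes J: "J \<subseteq> I" "open_interval J" and par: "\<And>t b. t \<in> J \<Longrightarrow> b \<in> Basis \<Longrightarrow> nrm t (X' b t) = 0"
    and V: "open V" "V \<subseteq> J \<times> UNIV"
  shows "locally_cylinder (ruled_map \<gamma> X) V"
proof -
  have opJ: "open J" and cJ: "convex J" and "J \<noteq> {}"
    using J(2) by (auto simp: open_interval_def is_interval_convex)
  then obtain s where s: "s \<in> J" "s \<in> I" using J(1) by blast
  have J_I: "t \<in> I" if "t \<in> J" for t using that J(1) by blast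
  have smX: "smooth_on J (X b)" if "b \<in> Basis" for b
    using smooth_on_subset[OF smooth_X[OF that] opJ J(1)] .
  have proj: "(\<Sum>b\<in>Basis. (ruling t v \<bullet> X b r) *\<^sub>R X b r) = ruling t v" if "t \<in> J" "r \<in> J" for t r v
    using nrm_ruling[OF J_I[OF that(1)], of v] ruling_projection_constant[OF J(1) opJ cJ par that(2,1), of "ruling t v"]
    by (simp add: nrm_def)
  \<comment> \<open>For \<open>t\<close> and \<open>r\<close> in \<open>J\<close>,
    \<open>C r t\<close> turns the coordinates of a ruling vector in the frame at \<open>t\<close>
    into its coordinates in the frame at \<open>r\<close>.\<close>
  define C where "C r t v = (\<Sum>b\<in>Basis. (ruling t v \<bullet> X b r) *\<^sub>R b)" for r t and v :: 'u
  have C_inner: "C r t v \<bullet> b = ruling t v \<bullet> X b r" if "b \<in> Basis" for r t v b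
    using that by (simp add: C_def inner_sum_left inner_Basis if_distrib[of "(*) _"] cong: if_cong)
  have ruling_C: "ruling r (C r t v) = ruling t v" if "t \<in> J" "r \<in> J" for r t v
    using proj[OF that, of v] by (simp add: ruling_def[of r] C_inner)
  have C_C: "C t r (C r t v) = v" if "t \<in> J" "r \<in> J" for r t v
    by (rule euclidean_eqI) (simp add: C_inner ruling_C that ruling_inner J_I)
  define \<phi> where "\<phi> p = (fst p, C s (fst p) (snd p))" for p :: "real \<times> 'u"
  define \<theta> where "\<theta> p = (fst p, C (fst p) s (snd p))" for p :: "real \<times> 'u"
  have op: "open (J \<times> (UNIV :: 'u set))"
    by (intro open_Times opJ open_UNIV)
  have Xfst: "smooth_on (J \<times> (UNIV :: 'u set)) (\<lambda>p. X b (fst p))" if "b \<in> Basis" for b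
    by (rule smooth_on_compose[OF smX[OF that]]) (auto intro: smooth_on_linear bounded_linear_fst op)
  have sm\<phi>: "smooth_on (J \<times> UNIV) \<phi>" and sm\<theta>: "smooth_on (J \<times> UNIV) \<theta>"
    unfolding \<phi>_def \<theta>_def C_def ruling_def by (intro smooth_intros op Xfst; assumption)+
  have d: "open (\<phi> ` V)" "diffeo_between V (\<phi> ` V) \<phi>"
    using diffeo_between_restrict[OF sm\<phi> sm\<theta> _ _ _ V] C_C s(1)
    by (auto simp: \<phi>_def \<theta>_def)
  have "cylinder_data J \<gamma> (\<lambda>b. X b s)"
    using J opJ smooth_on_subset[OF smooth_\<gamma> opJ J(1)] unit_speed orthonormal[OF s(2)] J_I
    by (auto simp: cylinder_data_def unit_speed_curve_def)
  moreover have "\<phi> ` V \<subseteq> J \<times> UNIV"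
    using V(2) by (auto simp: \<phi>_def)
  moreover have "ruled_map \<gamma> X x = cylinder_map \<gamma> (\<lambda>b. X b s) (\<phi> x)" if "x \<in> V" for x
  proof -
    have "fst x \<in> J" using that V(2) by auto
    then show ?thesis
      using ruling_C[of "fst x" s "snd x"] s(1)
      by (simp add: ruled_map_eq cylinder_map_def \<phi>_def ruling_def[of s])
  qed
  ultimately show ?thesis
    unfolding locally_cylinder_def using d by blast
qed

end

subsection \<open>The rank-one condition\<close>

locale rank_one_ruled_submanifold = ruled_submanifold I \<gamma> X
  for I :: "real set" and \<gamma> :: "real \<Rightarrow> 'a::euclidean_space" and X :: "'u::euclidean_space \<Rightarrow> real \<Rightarrow> 'a" +
  assumes rank_one: "rank_one (ruled_map \<gamma> X) (I \<times> UNIV)"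
begin

text \<open>The kernel of the second fundamental form has the dimension of the ruling. Either it
  contains a vector transversal to the rulings, and pairing it with \<open>(0, b)\<close> yields a
  nonzero multiple of \<open>X' b t\<close>; or it spans all ruling directions, and pairing these
  with \<open>(1, 0)\<close> yields \<open>X' b t\<close>.\<close>

lemma X'_mem_tangent_space:
  assumes "t \<in> I" "nrm t (velocity t u) \<noteq> 0" "b \<in> Basis"
  shows "X' b t \<in> tangent_space (ruled_map \<gamma> X) (t, u)" (is "_ \<in> ?T")
proof -
  let ?S = "second_deriv (ruled_map \<gamma> X) (t, u)"
  let ?K = "{v. \<forall>w. sff (ruled_map \<gamma> X) (t, u) v w = 0}"
  have T: "subspace ?T"
    unfolding tangent_space_def
    using has_derivative_linear[OF ruled_map_has_derivative[OF assms(1)]] assms(1)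
    by (auto simp: frechet_ruled_map intro!: linear_subspace_image)
  have mem: "?S v w \<in> ?T" if "v \<in> ?K" for v w
  proof (rule normal_part_eq_0_imp_mem[OF T])
    show "normal_part ?T (?S v w) = 0"
      using that unfolding sff_def by blast
  qed
  have dimK: "dim ?K = DIM('u)"
    using rank_one regular_point_ruled_map[OF assms(1,2)] assms(1)
    by (simp add: rank_one_def relative_nullity_def)
  show ?thesis
  proof (cases "\<exists>v\<in>?K. fst v \<noteq> 0")
    case True
    then obtain v where v: "v \<in> ?K" "fst v \<noteq> 0" by blast
    then have "inverse (fst v) *\<^sub>R ?S v (0, b) \<in> ?T"
      using mem T by (blast intro: subspace_mul)
    then show ?thesis
      using v(2) by (simp add: second_deriv_ruled_map(2)[OF assms(1,3)])
  next
    case False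
    \<comment> \<open>On vectors with \<open>fst v = 0\<close>, \<open>L\<close> is the second
      derivative paired with \<open>(1, 0)\<close>. Being linear, it carries membership in
      \<open>?T\<close> from \<open>?K\<close> to the span of \<open>?K\<close>.\<close>
    define L where "L v = (\<Sum>b\<in>Basis. (snd v \<bullet> b) *\<^sub>R X' b t)" for v :: "real \<times> 'u"
    have "linear L"
      by (rule linearI) (simp_all add: L_def inner_add_left scaleR_add_left sum.distrib scaleR_sum_right)
    have L: "L v \<in> ?T" if "v \<in> ?K" for v
    proof -
      have "fst v = 0"
        using False that by blast
      then show ?thesis
        using mem[OF that, of "(1, 0)"] by (simp add: second_deriv_ruled_map(1)[OF assms(1)] L_def)
    qed
    have "subspace (L -` ?T)"
      by (rule linear_subspace_vimage[OF \<open>linear L\<close> T])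
    then have LK: "span ?K \<subseteq> L -` ?T"
      using L by (intro span_minimal) auto
    let ?D = "range (Pair 0 :: 'u \<Rightarrow> real \<times> 'u)"
    have lin: "linear (Pair 0 :: 'u \<Rightarrow> real \<times> 'u)"
      by (rule linearI) auto
    have "subspace ?D"
      using lin by (intro linear_subspace_image) auto
    moreover have "?K \<subseteq> ?D"
    proof
      fix v
      assume "v \<in> ?K"
      then have "fst v = 0"
        using False by blast
      then show "v \<in> ?D"
        by (metis prod.collapse rangeI)
    qed
    moreover have "dim ?D = DIM('u)"
      using dim_image_eq[OF lin, of UNIV] by (simp add: inj_on_def)
    ultimately have "span ?K = ?D"
      using dimK by (metis dim_eq_span order_refl span_eq_iff)
    then have "L (0, b) \<in> ?T"
      using LK by blast
    then show ?thesis
      using assms(3) by (simp add: L_def inner_Basis if_distrib[of "\<lambda>r. r *\<^sub>R _"] cong: if_cong)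
  qed
qed

text \<open>At a regular point the tangent space modulo the ruling is the line of
  \<open>nrm t (velocity t u)\<close>, and every \<open>X' b t\<close> lies in that tangent space.
  Being nonzero, \<open>nrm t (X' c t)\<close> spans the same line.\<close>

lemma nrm_collinear:
  assumes "t \<in> I" "c \<in> Basis" "nrm t (X' c t) \<noteq> 0"
  shows "b \<in> Basis \<Longrightarrow> \<exists>r. nrm t (X' b t) = r *\<^sub>R nrm t (X' c t)"
    and "\<exists>r. nrm t (\<gamma>' t) = r *\<^sub>R nrm t (X' c t)"
proof -
  interpret N: linear "nrm t" by (rule linear_nrm)
  let ?e = "nrm t (X' c t)"
  \<comment> \<open>At the point \<open>s *\<^sub>R c\<close> of the ruling, \<open>nrm t\<close> of
    the velocity is \<open>nrm t (\<gamma>' t) + s *\<^sub>R ?e\<close>; this choice of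
    \<open>s\<close> keeps it nonzero.\<close>
  define s :: real where "s = (if nrm t (\<gamma>' t) = 0 then 1 else 0)"
  have vel: "velocity t (s *\<^sub>R c) = \<gamma>' t + s *\<^sub>R X' c t"
    using assms(2) by (simp add: velocity_def inner_Basis if_distrib[of "\<lambda>r. r *\<^sub>R _"]
        if_distrib[of "(*) _"] cong: if_cong)
  define f where "f = nrm t (velocity t (s *\<^sub>R c))"
  have f: "f = nrm t (\<gamma>' t) + s *\<^sub>R ?e"
    by (simp add: f_def vel N.add N.scale)
  have f0: "f \<noteq> 0"
    using assms(3) by (simp add: f s_def)
  have f_span: "\<exists>r. nrm t (X' b t) = r *\<^sub>R f" if b: "b \<in> Basis" for b
  proof -
    obtain v where "X' b t = fst v *\<^sub>R velocity t (s *\<^sub>R c) + ruling t (snd v)"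
      using X'_mem_tangent_space[OF assms(1) f0[unfolded f_def] b] assms(1)
      by (auto simp: tangent_space_def frechet_ruled_map)
    then have "nrm t (X' b t) = fst v *\<^sub>R f"
      by (simp add: N.add N.scale nrm_ruling assms(1) f_def)
    then show ?thesis ..
  qed
  obtain r where r: "?e = r *\<^sub>R f"
    using f_span[OF assms(2)] by blast
  with assms(3) have "r \<noteq> 0" by auto
  then have fe: "f = inverse r *\<^sub>R ?e"
    by (simp add: r)
  show "\<exists>r. nrm t (X' b t) = r *\<^sub>R ?e" if "b \<in> Basis"
    using f_span[OF that] fe by (metis scaleR_scaleR)
  have "nrm t (\<gamma>' t) = (inverse r - s) *\<^sub>R ?e"
    using f fe by (simp add: scaleR_diff_left algebra_simps)
  then show "\<exists>r. nrm t (\<gamma>' t) = r *\<^sub>R ?e" ..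
qed

end

subsection \<open>The edge of turning rulings\<close>

text \<open>Over \<open>J\<close> the rulings genuinely turn, and the singular points of each ruling form the
  hyperplane on which the velocity is tangent to the ruling. In the parameter \<open>q\<close> of this
  locale the coordinate along \<open>c\<close> is the curve parameter, the others are ruling coordinates;
  \<open>edge\<close> parametrizes the singular locus as a graph over them.\<close>

locale turning_ruled_submanifold = rank_one_ruled_submanifold I \<gamma> X
  for I :: "real set" and \<gamma> :: "real \<Rightarrow> 'a::euclidean_space" and X :: "'u::euclidean_space \<Rightarrow> real \<Rightarrow> 'a" +
  fixes J :: "real set" and c :: 'u
  assumes c_Basis: "c \<in> Basis" and open_J: "open J" and J_I: "J \<subseteq> I"
    and turning: "t \<in> J \<Longrightarrow> nrm t (X' c t) \<noteq> 0"
begin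

text \<open>\<open>slope\<close> and \<open>offset\<close> are the factors by which
  \<open>X' b t\<close> and \<open>\<gamma>' t\<close>, after \<open>nrm t\<close>, are multiples of
  \<open>nrm t (X' c t)\<close>. Quotients of inner products make them visibly smooth in
  \<open>t\<close>.\<close>

definition slope :: "'u \<Rightarrow> real \<Rightarrow> real" where
  "slope b t = (X' b t \<bullet> nrm t (X' c t)) / (nrm t (X' c t) \<bullet> nrm t (X' c t))"

definition offset :: "real \<Rightarrow> real" where
  "offset t = (\<gamma>' t \<bullet> nrm t (X' c t)) / (nrm t (X' c t) \<bullet> nrm t (X' c t))"

text \<open>Modulo the ruling, the velocity at \<open>(t, u)\<close> is
  \<open>nrm t (X' c t)\<close> times the sum of \<open>offset t\<close> and all
  \<open>(u \<bullet> b) * slope b t\<close>, where \<open>slope c t = 1\<close>. This is the value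
  of \<open>u \<bullet> c\<close> at which that factor vanishes.\<close>

definition height :: "'u \<Rightarrow> real" where
  "height q = - (offset (q \<bullet> c) + (\<Sum>b\<in>Basis - {c}. (q \<bullet> b) * slope b (q \<bullet> c)))"

definition foot :: "'u \<Rightarrow> 'u" where
  "foot q = q + (height q - q \<bullet> c) *\<^sub>R c"

definition edge :: "'u \<Rightarrow> 'a" where
  "edge q = ruled_map \<gamma> X (q \<bullet> c, foot q)"

abbreviation dedge :: "'u \<Rightarrow> 'u \<Rightarrow> 'a" where
  "dedge q \<equiv> frechet_derivative edge (at q)"

text \<open>Up to scaling, the only vector of the ruling orthogonal to the partials of \<open>edge\<close> in the
  directions \<open>b \<noteq> c\<close>.\<close>

definition conormal :: "real \<Rightarrow> 'a" where
  "conormal t = X c t + (\<Sum>b\<in>Basis - {c}. slope b t *\<^sub>R X b t)"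

definition domain :: "'u set" where
  "domain = {q. q \<bullet> c \<in> J}"

lemma in_I: "t \<in> J \<Longrightarrow> t \<in> I"
  using J_I by blast

lemma open_domain: "open domain"
  unfolding domain_def using open_vimage[OF open_J, of "\<lambda>q. q \<bullet> c"]
  by (simp add: vimage_def continuous_intros)

lemma sum_Basis: "(\<Sum>b\<in>Basis. f b) = f c + (\<Sum>b\<in>Basis - {c}. f b)"
  by (rule sum.remove[OF finite_Basis c_Basis])

lemma nrm_X': "t \<in> J \<Longrightarrow> b \<in> Basis \<Longrightarrow> nrm t (X' b t) = slope b t *\<^sub>R nrm t (X' c t)"
  and nrm_\<gamma>': "t \<in> J \<Longrightarrow> nrm t (\<gamma>' t) = offset t *\<^sub>R nrm t (X' c t)"
proof -
  assume t: "t \<in> J"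
  have *: "nrm t z = ((z \<bullet> nrm t (X' c t)) / (nrm t (X' c t) \<bullet> nrm t (X' c t))) *\<^sub>R nrm t (X' c t)"
    if "\<exists>r. nrm t z = r *\<^sub>R nrm t (X' c t)" for z
    using that turning[OF t] by (auto simp flip: nrm_inner_nrm[OF in_I[OF t], of z])
  show "nrm t (X' b t) = slope b t *\<^sub>R nrm t (X' c t)" if "b \<in> Basis"
    unfolding slope_def by (rule *[OF nrm_collinear(1)[OF in_I[OF t] c_Basis turning[OF t] that]])
  show "nrm t (\<gamma>' t) = offset t *\<^sub>R nrm t (X' c t)"
    unfolding offset_def by (rule *[OF nrm_collinear(2)[OF in_I[OF t] c_Basis turning[OF t]]])
qed

lemma slope_c: "t \<in> J \<Longrightarrow> slope c t = 1"
  by (metis c_Basis nrm_X' scaleR_cancel_right scaleR_one turning)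

lemma foot_inner_c: "foot q \<bullet> c = height q"
  using c_Basis by (simp add: foot_def inner_add_left)

lemma foot_inner: "b \<in> Basis \<Longrightarrow> b \<noteq> c \<Longrightarrow> foot q \<bullet> b = q \<bullet> b"
  using c_Basis by (simp add: foot_def inner_add_left inner_Basis)

lemma nrm_velocity_foot:
  assumes "q \<in> domain"
  shows "nrm (q \<bullet> c) (velocity (q \<bullet> c) (foot q)) = 0"
proof -
  let ?t = "q \<bullet> c"
  have t: "?t \<in> J" using assms by (simp add: domain_def)
  interpret N: linear "nrm ?t" by (rule linear_nrm)
  have "nrm ?t (velocity ?t (foot q))
      = (offset ?t + (\<Sum>b\<in>Basis. (foot q \<bullet> b) * slope b ?t)) *\<^sub>R nrm ?t (X' c ?t)"
    by (simp add: velocity_def N.add N.sum N.scale nrm_X' nrm_\<gamma>' t scaleR_add_left scaleR_sum_left)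
  also have "(\<Sum>b\<in>Basis. (foot q \<bullet> b) * slope b ?t) = - offset ?t"
    by (simp add: sum_Basis foot_inner_c slope_c t foot_inner) (simp add: height_def)
  finally show ?thesis by simp
qed

section \<open>Smoothness of the edge and its coefficients\<close>

lemma smooth_slope: "b \<in> Basis \<Longrightarrow> smooth_on J (slope b)" and smooth_offset: "smooth_on J offset"
proof -
  have X': "smooth_on J (X' b)" if "b \<in> Basis" for b
    by (rule smooth_on_subset[OF smooth_on_vector_derivative[OF smooth_X[OF that]] open_J J_I])
  have \<gamma>': "smooth_on J \<gamma>'"
    by (rule smooth_on_subset[OF smooth_on_vector_derivative[OF smooth_\<gamma>] open_J J_I])
  have e: "smooth_on J (\<lambda>t. nrm t (X' c t))"
    by (rule smooth_nrm[OF J_I X'[OF c_Basis]])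
  have ne: "nrm t (X' c t) \<bullet> nrm t (X' c t) \<noteq> 0" if "t \<in> J" for t
    using turning[OF that] by simp
  show "smooth_on J (slope b)" if "b \<in> Basis"
    unfolding slope_def[abs_def] by (intro smooth_intros X' e ne that)
  show "smooth_on J offset"
    unfolding offset_def[abs_def] by (intro smooth_intros \<gamma>' e ne)
qed

lemma smooth_domain_compose: "smooth_on J f \<Longrightarrow> smooth_on domain (\<lambda>q. f (q \<bullet> c))"
  by (rule smooth_on_compose[OF _ smooth_on_inner[OF smooth_on_ident[OF open_domain]
          smooth_on_const[OF open_domain]]]) (auto simp: domain_def)

lemma smooth_height: "smooth_on domain height"
  unfolding height_def[abs_def]
  by (intro smooth_intros smooth_domain_compose smooth_offset smooth_slope open_domain) auto

lemma smooth_foot: "smooth_on domain foot"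
  unfolding foot_def[abs_def] by (intro smooth_intros smooth_height open_domain)

lemma smooth_edge: "smooth_on domain edge"
  unfolding edge_def[abs_def]
proof (rule smooth_on_compose[OF smooth_ruled_map])
  show "smooth_on domain (\<lambda>q. (q \<bullet> c, foot q))"
    by (intro smooth_intros smooth_foot open_domain)
qed (auto simp: domain_def in_I)

lemma smooth_conormal: "smooth_on J conormal"
  unfolding conormal_def[abs_def]
  by (intro smooth_intros smooth_slope open_J smooth_on_subset[OF smooth_X open_J J_I] c_Basis) auto

section \<open>Differential of the edge\<close>

lemma height_derivative_Basis:
  assumes "q \<in> domain" "b \<in> Basis" "b \<noteq> c"
  shows "frechet_derivative height (at q) b = - slope b (q \<bullet> c)"
proof -
  let ?t = "q \<bullet> c"
  have t: "?t \<in> J" using assms by (simp add: domain_def)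
  have d: "((\<lambda>q. f (q \<bullet> c)) has_derivative (\<lambda>v. (v \<bullet> c) * vector_derivative f (at ?t))) (at q)"
    if "smooth_on J f" for f :: "real \<Rightarrow> real"
    using has_derivative_compose[OF has_derivative_inner_left[OF has_derivative_ident], of f _ q c]
      smooth_on_has_vector_derivative[OF that t]
    by (simp add: has_vector_derivative_def)
  have "(height has_derivative (\<lambda>v. - ((v \<bullet> c) * vector_derivative offset (at ?t)
      + (\<Sum>b\<in>Basis - {c}. (q \<bullet> b) * ((v \<bullet> c) * vector_derivative (slope b) (at ?t)) + (v \<bullet> b) * slope b ?t)))) (at q)"
    unfolding height_def[abs_def]
    by (intro has_derivative_minus has_derivative_add has_derivative_sum has_derivative_mult
        has_derivative_inner_left has_derivative_ident d smooth_offset smooth_slope) auto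
  \<comment> \<open>Since \<open>b \<bullet> c = 0\<close>, the curve parameter stays fixed in
    direction \<open>b\<close> and only the coefficient of \<open>q \<bullet> b\<close>
    survives.\<close>
  from fun_cong[OF frechet_derivative_at[OF this, symmetric], of b]
  show ?thesis
    using assms(2,3) c_Basis by (simp add: inner_Basis if_distrib[of "\<lambda>r. r * _"] cong: if_cong)
qed

lemma edge_derivative:
  assumes "q \<in> domain"
  shows "dedge q v = (v \<bullet> c) *\<^sub>R velocity (q \<bullet> c) (foot q)
      + ruling (q \<bullet> c) (v + (frechet_derivative height (at q) v - v \<bullet> c) *\<^sub>R c)"
proof -
  have t: "q \<bullet> c \<in> I" using assms in_I by (simp add: domain_def)
  have h: "(height has_derivative frechet_derivative height (at q)) (at q)"
    by (rule smooth_on_has_derivative[OF smooth_height assms])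
  have "((\<lambda>q. (q \<bullet> c, foot q)) has_derivative
      (\<lambda>v. (v \<bullet> c, v + (frechet_derivative height (at q) v - v \<bullet> c) *\<^sub>R c))) (at q)"
    unfolding foot_def
    by (intro has_derivative_Pair has_derivative_add has_derivative_ident has_derivative_inner_left
        has_derivative_scaleR_left has_derivative_diff h)
  from has_derivative_compose[OF this ruled_map_has_derivative[OF t]]
  have "(edge has_derivative (\<lambda>v. (v \<bullet> c) *\<^sub>R velocity (q \<bullet> c) (foot q)
      + ruling (q \<bullet> c) (v + (frechet_derivative height (at q) v - v \<bullet> c) *\<^sub>R c))) (at q)"
    by (simp add: edge_def[abs_def])
  from fun_cong[OF frechet_derivative_at[OF this]] show ?thesis by simp
qed

lemma dedge_Basis:
  assumes "q \<in> domain" "b \<in> Basis" "b \<noteq> c"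
  shows "dedge q b = X b (q \<bullet> c) - slope b (q \<bullet> c) *\<^sub>R X c (q \<bullet> c)"
proof -
  interpret R: linear "ruling (q \<bullet> c)" by (rule linear_ruling)
  have "b \<bullet> c = 0"
    using assms c_Basis by (simp add: inner_Basis)
  then show ?thesis
    by (simp add: edge_derivative height_derivative_Basis assms R.add R.diff R.neg R.scale ruling_Basis c_Basis)
qed

text \<open>The edge consists of singular points, where the velocity itself lies in the ruling. So
  even moving the curve parameter keeps the differential inside the ruling.\<close>

lemma dedge_c_in_span: "q \<in> domain \<Longrightarrow> dedge q c \<in> span ((\<lambda>b. X b (q \<bullet> c)) ` Basis)"
  using nrm_velocity_foot[of q] nrm_eq_0_iff[of "q \<bullet> c" "velocity (q \<bullet> c) (foot q)"] in_I
  by (simp add: edge_derivative domain_def span_add span_scale ruling_in_span)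

text \<open>By \<open>dedge_Basis\<close> each frame vector \<open>X b\<close> with
  \<open>b \<noteq> c\<close> is \<open>dedge q b\<close> plus a multiple of \<open>X c\<close>.
  After substitution in the frame expansion of \<open>dedge q c\<close>, the multiples of
  \<open>X c\<close> collect to the inner product with \<open>conormal\<close>, the number that
  separates cones from tangent submanifolds.\<close>

lemma dedge_c_eq:
  assumes "q \<in> domain"
  shows "dedge q c = (\<Sum>b\<in>Basis - {c}. (dedge q c \<bullet> X b (q \<bullet> c)) *\<^sub>R dedge q b)
      + (dedge q c \<bullet> conormal (q \<bullet> c)) *\<^sub>R X c (q \<bullet> c)"
proof -
  let ?t = "q \<bullet> c" and ?p = "dedge q c"
  have t: "?t \<in> I" using assms in_I by (simp add: domain_def)
  have "?p = (\<Sum>b\<in>Basis. (?p \<bullet> X b ?t) *\<^sub>R X b ?t)"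
    using dedge_c_in_span[OF assms] nrm_eq_0_iff[OF t, of ?p] by (simp add: nrm_def)
  also have "\<dots> = (?p \<bullet> X c ?t) *\<^sub>R X c ?t
      + (\<Sum>b\<in>Basis - {c}. (?p \<bullet> X b ?t) *\<^sub>R (dedge q b + slope b ?t *\<^sub>R X c ?t))"
    by (simp add: sum_Basis dedge_Basis assms)
  also have "\<dots> = (\<Sum>b\<in>Basis - {c}. (?p \<bullet> X b ?t) *\<^sub>R dedge q b)
      + (?p \<bullet> conormal ?t) *\<^sub>R X c ?t"
    by (simp add: conormal_def inner_add_right inner_sum_right scaleR_add_right scaleR_add_left
        sum.distrib scaleR_sum_left mult.commute)
  finally show ?thesis .
qed

text \<open>The slopes are the frame coordinates of \<open>conormal t\<close>, the one at
  \<open>c\<close> being 1.\<close>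

lemma conormal_X:
  assumes "t \<in> J" "b \<in> Basis"
  shows "X b t \<bullet> conormal t = slope b t"
proof -
  define w where "w = (\<Sum>b\<in>Basis. slope b t *\<^sub>R b)"
  have w: "w \<bullet> b = slope b t" if "b \<in> Basis" for b
    using that by (simp add: w_def inner_sum_left inner_Basis if_distrib[of "(*) _"] cong: if_cong)
  have "ruling t w = (\<Sum>b\<in>Basis. slope b t *\<^sub>R X b t)"
    by (simp add: ruling_def w)
  then have "conormal t = ruling t w"
    by (simp add: sum_Basis slope_c assms conormal_def)
  then show ?thesis
    using assms in_I by (simp add: ruling_inner inner_commute[of "X b t"] w)
qed

lemma conormal_dedge:
  assumes "q \<in> domain" "b \<in> Basis" "b \<noteq> c"
  shows "dedge q b \<bullet> conormal (q \<bullet> c) = 0"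
  using assms c_Basis by (simp add: dedge_Basis inner_diff_left conormal_X slope_c domain_def)

text \<open>Every partial is now orthogonal to \<open>conormal\<close>, while \<open>X c\<close> has
  inner product 1 with it. Partials and \<open>X c\<close> together span the whole ruling, so the
  partials fall exactly one dimension short of it.\<close>

lemma cone_data_edge:
  assumes "open U" "U \<subseteq> domain" "\<And>q. q \<in> U \<Longrightarrow> dedge q c \<bullet> conormal (q \<bullet> c) = 0"
  shows "cone_data U edge (\<lambda>q. X c (q \<bullet> c))"
proof -
  have "dim (partials edge q) = DIM('u) - 1 \<and> norm (X c (q \<bullet> c)) = 1 \<and> X c (q \<bullet> c) \<notin> span (partials edge q)"
    if "q \<in> U" for q
  proof -
    let ?t = "q \<bullet> c" and ?P = "partials edge q" and ?B = "(\<lambda>b. X b (q \<bullet> c)) ` Basis"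
    have q: "q \<in> domain" using that assms(2) by blast
    then have J: "?t \<in> J" and I: "?t \<in> I" using in_I by (auto simp: domain_def)
    have perp: "dedge q b \<bullet> conormal ?t = 0" if "b \<in> Basis" for b
      using conormal_dedge[OF q that] assms(3)[OF \<open>q \<in> U\<close>] by (cases "b = c") auto
    have "z \<bullet> conormal ?t = 0" if "z \<in> span ?P" for z
      using that by (induction rule: span_induct_alt) (auto simp: partials_def inner_add_left perp)
    moreover have "X c ?t \<bullet> conormal ?t = 1"
      by (simp add: conormal_X slope_c J c_Basis)
    ultimately have notin: "X c ?t \<notin> span ?P"
      by force
    have sub: "X b ?t \<in> span (insert (X c ?t) ?P)" if b: "b \<in> Basis" for b
    proof (cases "b = c")
      case False
      have "dedge q b + slope b ?t *\<^sub>R X c ?t \<in> span (insert (X c ?t) ?P)"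
        using b by (intro span_add span_scale span_base) (auto simp: partials_def)
      then show ?thesis
        using dedge_Basis[OF q b False] by simp
    qed (simp add: span_base)
    have "dedge q b \<in> span ?B" if b: "b \<in> Basis" for b
    proof (cases "b = c")
      case True
      then show ?thesis using dedge_c_in_span[OF q] by simp
    next
      case False
      show ?thesis
        unfolding dedge_Basis[OF q b False]
        using b c_Basis by (intro span_diff span_scale span_base) auto
    qed
    then have "span (insert (X c ?t) ?P) = span ?B"
      using sub c_Basis by (intro equalityI span_minimal) (auto simp: partials_def intro: span_base)
    then have "dim (insert (X c ?t) ?P) = DIM('u)"
      using dim_ruling_basis[OF I] by (metis dim_span)
    then have "dim ?P = DIM('u) - 1"
      using notin by (simp add: dim_insert)
    then show ?thesis
      using notin orthonormal[OF I c_Basis c_Basis] by (simp add: norm_eq_sqrt_inner)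
  qed
  moreover have "smooth_on U (\<lambda>q. X c (q \<bullet> c))"
    by (intro smooth_on_subset[OF smooth_domain_compose assms(1,2)] smooth_on_subset[OF smooth_X] c_Basis open_J J_I)
  ultimately show ?thesis
    using assms(1) smooth_on_subset[OF smooth_edge assms(1,2)] by (simp add: cone_data_def)
qed

text \<open>The inner product with \<open>conormal\<close> isolates the \<open>c\<close>-coordinate
  of a kernel vector of \<open>dedge q\<close>, since the other partials are orthogonal to it; inner
  products with \<open>X b\<close> then isolate the other coordinates.\<close>

lemma tangent_data_edge:
  assumes "open U" "U \<subseteq> domain" "\<And>q. q \<in> U \<Longrightarrow> dedge q c \<bullet> conormal (q \<bullet> c) \<noteq> 0"
  shows "tangent_data U edge (\<lambda>q. X c (q \<bullet> c))"
proof -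
  have "regular_point edge q \<and> norm (X c (q \<bullet> c)) = 1 \<and> wedge_zero edge q (X c (q \<bullet> c))"
    if "q \<in> U" for q
  proof -
    let ?t = "q \<bullet> c"
    have q: "q \<in> domain" using that assms(2) by blast
    then have J: "?t \<in> J" and I: "?t \<in> I" using in_I by (auto simp: domain_def)
    let ?r = "dedge q c \<bullet> conormal ?t"
    have r: "?r \<noteq> 0" using assms(3)[OF that] .
    have der: "(edge has_derivative dedge q) (at q)"
      by (rule smooth_on_has_derivative[OF smooth_edge q])
    interpret L: linear "dedge q"
      by (rule has_derivative_linear[OF der])
    have expand: "dedge q v = (v \<bullet> c) *\<^sub>R dedge q c + (\<Sum>b\<in>Basis - {c}. (v \<bullet> b) *\<^sub>R dedge q b)" for v
    proof -
      have "dedge q v = dedge q (\<Sum>b\<in>Basis. (v \<bullet> b) *\<^sub>R b)"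
        by (simp add: euclidean_representation)
      also have "\<dots> = (\<Sum>b\<in>Basis. (v \<bullet> b) *\<^sub>R dedge q b)"
        by (simp only: L.sum L.scale)
      finally show ?thesis by (simp only: sum_Basis)
    qed
    have "v = 0" if "dedge q v = 0" for v
    proof -
      have "dedge q v \<bullet> conormal ?t = (v \<bullet> c) * ?r"
        by (subst expand) (simp add: inner_add_left inner_sum_left conormal_dedge q)
      then have vc: "v \<bullet> c = 0" using that r by simp
      have "v \<bullet> b = 0" if b: "b \<in> Basis" "b \<noteq> c" for b
      proof -
        have "dedge q v \<bullet> X b ?t = (\<Sum>d\<in>Basis - {c}. (v \<bullet> d) * (if d = b then 1 else 0))"
          by (subst expand) (auto simp: vc inner_sum_left dedge_Basis q inner_diff_left orthonormal I b b(2)[symmetric] c_Basis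
              intro!: sum.cong)
        also have "\<dots> = v \<bullet> b"
          using b by (simp add: if_distrib[of "(*) _"] cong: if_cong)
        finally show ?thesis using \<open>dedge q v = 0\<close> by simp
      qed
      with vc show ?thesis
        by (metis euclidean_all_zero_iff)
    qed
    then have "inj (dedge q)"
      using L.linear_axioms linear_injective_0 by blast
    then have reg: "regular_point edge q"
      using der by (auto simp: regular_point_def differentiable_def)
    \<comment> \<open>The coefficients come from moving \<open>dedge q c\<close> to the other side
      of \<open>dedge_c_eq\<close>, hence \<open>-1\<close> at \<open>c\<close>.\<close>
    have "wedge_zero edge q (X c ?t)"
      unfolding wedge_zero_def
    proof (intro exI conjI)
      show "?r \<noteq> 0 \<or> (\<exists>b\<in>Basis. (if b = c then -1 else dedge q c \<bullet> X b ?t) \<noteq> 0)"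
        using r by blast
      have "(\<Sum>b\<in>Basis. (if b = c then -1 else dedge q c \<bullet> X b ?t) *\<^sub>R dedge q b)
          = - dedge q c + (\<Sum>b\<in>Basis - {c}. (dedge q c \<bullet> X b ?t) *\<^sub>R dedge q b)"
        by (auto simp: sum_Basis intro!: sum.cong)
      also have "\<dots> = - ?r *\<^sub>R X c ?t"
        using dedge_c_eq[OF q] by (simp add: algebra_simps)
      finally show "?r *\<^sub>R X c ?t + (\<Sum>b\<in>Basis. (if b = c then -1 else dedge q c \<bullet> X b ?t) *\<^sub>R dedge q b) = 0"
        by simp
    qed
    then show ?thesis
      using reg orthonormal[OF I c_Basis c_Basis] by (simp add: norm_eq_sqrt_inner)
  qed
  moreover have "smooth_on U (\<lambda>q. X c (q \<bullet> c))"
    by (intro smooth_on_subset[OF smooth_domain_compose assms(1,2)] smooth_on_subset[OF smooth_X] c_Basis open_J J_I)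
  ultimately show ?thesis
    using assms(1) smooth_on_subset[OF smooth_edge assms(1,2)] by (simp add: tangent_data_def)
qed

section \<open>Coordinates along the lines through the edge\<close>

definition base :: "real \<times> 'u \<Rightarrow> 'u" where
  "base p = snd p + (fst p - snd p \<bullet> c) *\<^sub>R c"

text \<open>\<open>base\<close> overwrites the ruling coordinate along \<open>c\<close> by the curve
  parameter and so picks the edge point whose line in direction \<open>X c\<close> meets the given
  point; the overwritten coordinate is kept as signed distance from the edge.\<close>

definition chart :: "real \<times> 'u \<Rightarrow> 'u \<times> real" where
  "chart p = (base p, snd p \<bullet> c - height (base p))"

lemma base_inner_c: "base p \<bullet> c = fst p"
  using c_Basis by (simp add: base_def inner_add_left)

lemma smooth_base: "open S \<Longrightarrow> smooth_on S base"
  unfolding base_def[abs_def]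
  by (intro smooth_intros smooth_on_linear[OF bounded_linear_fst] smooth_on_linear[OF bounded_linear_snd])

lemma chart_props:
  assumes "open V" "V \<subseteq> J \<times> UNIV"
  shows "open (chart ` V)" "diffeo_between V (chart ` V) chart" "open (base ` V)" "base ` V \<subseteq> domain"
    "chart ` V \<subseteq> base ` V \<times> UNIV"
    "\<And>x. x \<in> V \<Longrightarrow> ruled_map \<gamma> X x = line_map edge (\<lambda>q. X c (q \<bullet> c)) (chart x)"
proof -
  \<comment> \<open>The inverse of \<open>chart\<close>: moving from the edge point by
    \<open>snd y\<close> along \<open>X c\<close> adds \<open>snd y\<close> to the
    \<open>c\<close>-coordinate of \<open>foot\<close>.\<close>
  define \<theta> where "\<theta> y = (fst y \<bullet> c, foot (fst y) + snd y *\<^sub>R c)" for y :: "'u \<times> real"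
  have \<theta>chart: "\<theta> (chart x) = x" for x
    by (simp add: \<theta>_def chart_def foot_def base_inner_c prod_eq_iff)
      (simp add: base_def algebra_simps)
  have base\<theta>: "base (\<theta> y) = fst y" for y
    using c_Basis by (simp add: base_def \<theta>_def inner_add_left foot_inner_c) (simp add: foot_def algebra_simps)
  have chart\<theta>: "chart (\<theta> y) = y" for y
    using c_Basis by (simp add: chart_def base\<theta> prod_eq_iff) (simp add: \<theta>_def inner_add_left foot_inner_c)
  have op: "open (J \<times> (UNIV :: 'u set))" "open (domain \<times> (UNIV :: real set))"
    using open_J open_domain by (auto intro: open_Times)
  have bd: "base x \<in> domain" if "x \<in> J \<times> UNIV" for x
    using that by (auto simp: domain_def base_inner_c)
  have smc: "smooth_on (J \<times> UNIV) chart"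
    unfolding chart_def[abs_def]
    by (intro smooth_intros smooth_base smooth_on_compose[OF smooth_height] op smooth_on_linear[OF bounded_linear_snd])
      (use bd in auto)
  have sm\<theta>: "smooth_on (domain \<times> UNIV) \<theta>"
    unfolding \<theta>_def[abs_def]
    by (intro smooth_intros smooth_on_compose[OF smooth_foot] op smooth_on_linear[OF bounded_linear_fst]
        smooth_on_linear[OF bounded_linear_snd]) auto
  show 1: "open (chart ` V)" and "diffeo_between V (chart ` V) chart"
    using diffeo_between_restrict[OF smc sm\<theta> _ _ _ assms] bd \<theta>chart chart\<theta> by (auto simp: chart_def)
  have "base ` V = fst ` chart ` V"
    by (auto simp: chart_def image_image)
  then show "open (base ` V)"
    using open_image_fst[OF 1] by simp
  show "base ` V \<subseteq> domain"
    using bd assms(2) by blast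
  show "chart ` V \<subseteq> base ` V \<times> UNIV"
    by (auto simp: chart_def)
  show "ruled_map \<gamma> X x = line_map edge (\<lambda>q. X c (q \<bullet> c)) (chart x)" if "x \<in> V" for x
  proof -
    interpret R: linear "ruling (fst (chart x) \<bullet> c)" by (rule linear_ruling)
    have "line_map edge (\<lambda>q. X c (q \<bullet> c)) (chart x) = ruled_map \<gamma> X (\<theta> (chart x))"
      using c_Basis by (simp add: line_map_def edge_def ruled_map_eq \<theta>_def R.add R.scale ruling_Basis)
    then show ?thesis by (simp add: \<theta>chart)
  qed
qed

text \<open>If the inner product of \<open>dedge q c\<close> with
  \<open>conormal (q \<bullet> c)\<close> vanishes for all \<open>q\<close> below \<open>N\<close>,
  all of \<open>N\<close> is conical; otherwise the points where it does not vanish form a nonempty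
  open piece, which is tangent.\<close>

lemma cone_or_tangent:
  assumes "open N" "N \<subseteq> J \<times> UNIV" "N \<noteq> {}"
  shows "\<exists>V\<subseteq>N. open V \<and> V \<noteq> {} \<and>
    (locally_cone (ruled_map \<gamma> X) V \<or> locally_tangent (ruled_map \<gamma> X) V)"
proof -
  let ?r = "\<lambda>q. dedge q c \<bullet> conormal (q \<bullet> c)"
  have sub: "base ` N \<subseteq> domain"
    by (rule chart_props(4)[OF assms(1,2)])
  have "smooth_on domain ?r"
    by (intro smooth_intros smooth_domain_compose smooth_conormal smooth_on_frechet_derivative smooth_edge)
  from smooth_on_continuous[OF smooth_on_compose[OF this smooth_base[OF assms(1)] sub]]
  have cont: "continuous_on N (\<lambda>x. ?r (base x))" .
  define V where "V = {x \<in> N. ?r (base x) \<noteq> 0}"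
  have V: "open V" "V \<subseteq> N"
    using continuous_open_preimage[OF cont assms(1), of "- {0}"]
    by (auto simp: V_def vimage_def Int_def)
  show ?thesis
  proof (cases "V = {}")
    case True
    have "cone_data (base ` N) edge (\<lambda>q. X c (q \<bullet> c))"
      using True sub by (intro cone_data_edge chart_props(3)[OF assms(1,2)]) (auto simp: V_def)
    then have "locally_cone (ruled_map \<gamma> X) N"
      unfolding locally_cone_def using chart_props[OF assms(1,2)] by blast
    then show ?thesis using assms by blast
  next
    case False
    have VJ: "V \<subseteq> J \<times> UNIV" using V assms by blast
    have "tangent_data (base ` V) edge (\<lambda>q. X c (q \<bullet> c))"
      using chart_props(4)[OF V(1) VJ]
      by (intro tangent_data_edge chart_props(3)[OF V(1) VJ]) (auto simp: V_def)
    then have "locally_tangent (ruled_map \<gamma> X) V"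
      unfolding locally_tangent_def using chart_props[OF V(1) VJ] by blast
    then show ?thesis using V False by blast
  qed
qed

end

section \<open>Density of the elementary pieces\<close>

context rank_one_ruled_submanifold
begin

text \<open>In a box inside \<open>N\<close>, either no \<open>X' b\<close> leaves the ruling over
  the whole interval, which is the parallel case, or some \<open>X' c\<close> does at one parameter
  and hence, by continuity, on an open set of parameters, where the turning case applies.\<close>

lemma exists_elementary_piece:
  assumes "open N" "N \<subseteq> I \<times> UNIV" "N \<noteq> {}"
  shows "\<exists>V\<subseteq>N. open V \<and> V \<noteq> {} \<and>
    (locally_cylinder (ruled_map \<gamma> X) V \<or> locally_cone (ruled_map \<gamma> X) V \<or> locally_tangent (ruled_map \<gamma> X) V)"
proof -
  obtain s u where su: "(s, u) \<in> N" using assms(3) by (metis ex_in_conv surj_pair)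
  then obtain A B where AB: "open A" "open B" "s \<in> A" "u \<in> B" "A \<times> B \<subseteq> N"
    using open_prod_elim[OF assms(1) su] by (metis mem_Sigma_iff)
  then obtain r where r: "r > 0" "ball s r \<subseteq> A"
    using open_contains_ball by blast
  let ?J = "ball s r"
  have J_I: "?J \<subseteq> I" using r AB assms(2) by blast
  show ?thesis
  proof (cases "\<forall>t\<in>?J. \<forall>b\<in>Basis. nrm t (X' b t) = 0")
    case True
    have "open_interval ?J"
      using r by (simp add: open_interval_def is_interval_convex_1)
    then have "locally_cylinder (ruled_map \<gamma> X) (?J \<times> B)"
      using True J_I AB by (intro locally_cylinder_if_parallel[of ?J]) (auto intro: open_Times)
    moreover have "?J \<times> B \<subseteq> N" "open (?J \<times> B)" "?J \<times> B \<noteq> {}"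
      using r AB by (auto intro: open_Times)
    ultimately show ?thesis by blast
  next
    case False
    then obtain t c where t: "t \<in> ?J" "c \<in> Basis" "nrm t (X' c t) \<noteq> 0" by blast
    define K where "K = {t \<in> ?J. nrm t (X' c t) \<noteq> 0}"
    have "smooth_on ?J (\<lambda>t. nrm t (X' c t))"
      by (intro smooth_nrm J_I smooth_on_subset[OF smooth_on_vector_derivative[OF smooth_X[OF t(2)]] open_ball J_I])
    then have "open K"
      using continuous_open_preimage[OF smooth_on_continuous open_ball, of s r "\<lambda>t. nrm t (X' c t)" "- {0}"]
      by (auto simp: K_def vimage_def Int_def)
    interpret turning_ruled_submanifold I \<gamma> X K c
      by unfold_locales (use \<open>open K\<close> t J_I in \<open>auto simp: K_def\<close>)
    have "K \<times> B \<subseteq> N" "open (K \<times> B)" "K \<times> B \<noteq> {}"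
      using r AB t \<open>open K\<close> by (auto simp: K_def intro: open_Times)
    moreover obtain V where "V \<subseteq> K \<times> B" "open V" "V \<noteq> {}"
      "locally_cone (ruled_map \<gamma> X) V \<or> locally_tangent (ruled_map \<gamma> X) V"
      using cone_or_tangent[of "K \<times> B"] calculation by blast
    ultimately show ?thesis by blast
  qed
qed

end

theorem theorem1p2:
  fixes I :: "real set"
    and \<gamma> :: "real \<Rightarrow> 'a::euclidean_space"
    and X :: "'u::euclidean_space \<Rightarrow> real \<Rightarrow> 'a"
  assumes "DIM(real \<times> 'u) \<le> DIM('a)"
    and "ruled_data I \<gamma> X"
    and "rank_one (ruled_map \<gamma> X) (I \<times> UNIV)"
  shows "\<exists>W. open W \<and> W \<subseteq> I \<times> UNIV \<and> I \<times> UNIV \<subseteq> closure W \<and>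
           (\<forall>p\<in>W. \<exists>V. open V \<and> p \<in> V \<and> V \<subseteq> W \<and>
              (locally_cylinder (ruled_map \<gamma> X) V \<or> locally_cone (ruled_map \<gamma> X) V \<or>
               locally_tangent (ruled_map \<gamma> X) V))"
proof -
  interpret rank_one_ruled_submanifold I \<gamma> X
    using assms by unfold_locales
  let ?elem = "\<lambda>V. locally_cylinder (ruled_map \<gamma> X) V \<or> locally_cone (ruled_map \<gamma> X) V \<or>
    locally_tangent (ruled_map \<gamma> X) V"
  \<comment> \<open>Taking all elementary open sets makes the local claim immediate; density is
    where \<open>exists_elementary_piece\<close> enters.\<close>
  define W where "W = \<Union>{V. open V \<and> V \<subseteq> I \<times> UNIV \<and> ?elem V}"
  have "open W"
    unfolding W_def by (intro open_Union) blast
  moreover have "W \<subseteq> I \<times> UNIV"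
    unfolding W_def by blast
  moreover have "I \<times> UNIV \<subseteq> closure W"
  proof (intro subsetI, subst closure_iff_nhds_not_empty, intro allI impI)
    fix p :: "real \<times> 'u" and A S
    assume p: "p \<in> I \<times> UNIV" and S: "S \<subseteq> A" "open S" "p \<in> S"
    have "open (S \<inter> I \<times> UNIV)"
      using S open_I by (intro open_Int open_Times) auto
    then obtain V where "V \<subseteq> S \<inter> I \<times> UNIV" "open V" "V \<noteq> {}" "?elem V"
      using exists_elementary_piece[of "S \<inter> I \<times> UNIV"] p S by blast
    then show "W \<inter> A \<noteq> {}"
      using S(1) unfolding W_def by blast
  qed
  moreover have "\<exists>V. open V \<and> p \<in> V \<and> V \<subseteq> W \<and> ?elem V" if "p \<in> W" for p
    using that unfolding W_def by blast
  ultimately show ?thesis by blast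
qed

end
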